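(* Let $p$ be an odd prime and let $G$ be a finite $2$-generator $p$-group of nilpotency class two. Then $D(G) = L(G)$ if one of the following holds: (1) $G \cong (\langle c\rangle \times \langle a \rangle) \rtimes \langle b \rangle$ where $[a,b]=c$, $[a,c]=[b,c]=1$, $o(a)=p^{\alpha}$, $o(b)=p^{\beta}$, $o(c)=p^{\gamma}$, with $\alpha,\beta,\gamma \in \mathbb{N}$, $\alpha \ge \beta \ge \gamma \ge 1$, and $\gamma = 1$; (2) $G \cong \langle a \rangle \rtimes \langle b \rangle$ where $[a,b] = a^{p^{\alpha-\gamma}}$, $o(a)=p^{\alpha}$, $o(b)=p^{\beta}$, $o([a,b])=p^{\gamma}$, with $\alpha,\beta,\gamma\in\mathbb{N}$, $\alpha \ge 2\gamma$, $\beta \ge \gamma \ge 1$; (3) $G \cong (\langle c\rangle \times \langle a \rangle) \rtimes \langle b \rangle$ where $[a,b] = a^{p^{\alpha-\gamma}}c$, $[c,b] = a^{-p^{2(\alpha-\gamma)}} c^{-p^{\alpha-\gamma}}$, $o(a)=p^{\alpha}$, $o(b)=p^{\beta}$, $o(c)=p^{\sigma}$, with $\alpha,\beta,\gamma,\sigma\in\mathbb{N}$, $\beta \ge \gamma > \sigma \ge 1$, $\alpha+\sigma \ge 2\gamma$, and $\sigma = 1$.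
   Context: Commutators are $[x,y] = x^{-1}y^{-1}xy$. $o(g)$ is the order of $g$. For a finite group $G$, $D(G)$ denotes the least positive integer $k$ such that for every sequence $g_1 g_2 \cdots g_k$ of length $k$ of elements of $G$ (repetitions allowed) there exist indices $1 \le i_1 < \cdots < i_m \le k$, $m\ge 1$, with $g_{i_1} g_{i_2}\cdots g_{i_m} = 1$ (product in order of increasing indices). For a finite $p$-group $G$, $L(G)$ is the Loewy length of the group algebra $\mathbb{F}_pG$, i.e. the nilpotency index of its Jacobson radical (equivalently, of the augmentation ideal): the least $t$ with $J^t = 0$. *)

theory Defs
  imports "HOL-Algebra.Algebra" "HOL-Number_Theory.Residues"
begin

definition commutator :: "('a, 'b) monoid_scheme \<Rightarrow> 'a \<Rightarrow> 'a \<Rightarrow> 'a" where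
  "commutator G x y =
     inv\<^bsub>G\<^esub> x \<otimes>\<^bsub>G\<^esub> inv\<^bsub>G\<^esub> y \<otimes>\<^bsub>G\<^esub> x \<otimes>\<^bsub>G\<^esub> y"

text \<open>The indexing starts at \<open>0\<close>, so that a group has nilpotency class \<open>c\<close> iff
  \<open>c\<close> is the first index at which the series is trivial.\<close>

primrec lower_central_series :: "('a, 'b) monoid_scheme \<Rightarrow> nat \<Rightarrow> 'a set" where
  "lower_central_series G 0 = carrier G"
| "lower_central_series G (Suc i) =
     generate G {commutator G x y | x y. x \<in> lower_central_series G i \<and> y \<in> carrier G}"

definition nilpotent_of_class :: "('a, 'b) monoid_scheme \<Rightarrow> nat \<Rightarrow> bool" where
  "nilpotent_of_class G c \<longleftrightarrow>
     lower_central_series G c = {\<one>\<^bsub>G\<^esub>} \<and>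
     (\<forall>i<c. lower_central_series G i \<noteq> {\<one>\<^bsub>G\<^esub>})"

definition internal_direct_product ::
    "('a, 'b) monoid_scheme \<Rightarrow> 'a set \<Rightarrow> 'a set \<Rightarrow> 'a set \<Rightarrow> bool" where
  "internal_direct_product G N A B \<longleftrightarrow>
     subgroup A G \<and> subgroup B G \<and>
     (\<forall>x\<in>A. \<forall>y\<in>B. x \<otimes>\<^bsub>G\<^esub> y = y \<otimes>\<^bsub>G\<^esub> x) \<and>
     A \<inter> B = {\<one>\<^bsub>G\<^esub>} \<and> N = A <#>\<^bsub>G\<^esub> B"

definition internal_semidirect_product ::
    "('a, 'b) monoid_scheme \<Rightarrow> 'a set \<Rightarrow> 'a set \<Rightarrow> bool" where
  "internal_semidirect_product G N K \<longleftrightarrow>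
     N \<lhd> G \<and> subgroup K G \<and>
     N \<inter> K = {\<one>\<^bsub>G\<^esub>} \<and> N <#>\<^bsub>G\<^esub> K = carrier G"

text \<open>\<open>nths gs I\<close> lists the entries of \<open>gs\<close> at the positions in \<open>I\<close>, in order of
  increasing position.\<close>

definition davenport_constant :: "('a, 'b) monoid_scheme \<Rightarrow> nat" where
  "davenport_constant G =
     (LEAST k. 0 < k \<and>
        (\<forall>gs. length gs = k \<and> set gs \<subseteq> carrier G \<longrightarrow>
           (\<exists>I. I \<noteq> {} \<and> I \<subseteq> {..<k} \<and>
              foldr (\<otimes>\<^bsub>G\<^esub>) (nths gs I) \<one>\<^bsub>G\<^esub> = \<one>\<^bsub>G\<^esub>)))"

text \<open>The group algebra of a finite group, with elements represented by their coefficient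
  functions; the product is convolution.\<close>

definition group_algebra ::
    "('k, 'm) ring_scheme \<Rightarrow> ('a, 'b) monoid_scheme \<Rightarrow> ('a \<Rightarrow> 'k) ring" where
  "group_algebra R G =
     \<lparr> carrier = carrier G \<rightarrow>\<^sub>E carrier R,
       monoid.mult = (\<lambda>f h. \<lambda>x\<in>carrier G.
         finsum R (\<lambda>y. f y \<otimes>\<^bsub>R\<^esub> h (inv\<^bsub>G\<^esub> y \<otimes>\<^bsub>G\<^esub> x)) (carrier G)),
       one = (\<lambda>x\<in>carrier G. if x = \<one>\<^bsub>G\<^esub> then \<one>\<^bsub>R\<^esub> else \<zero>\<^bsub>R\<^esub>),
       ring.zero = (\<lambda>x\<in>carrier G. \<zero>\<^bsub>R\<^esub>),
       add = (\<lambda>f h. \<lambda>x\<in>carrier G. f x \<oplus>\<^bsub>R\<^esub> h x) \<rparr>"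

lemma (in ring) finsum_swap:
  assumes "finite A" "finite B" and "\<And>x y. x \<in> A \<Longrightarrow> y \<in> B \<Longrightarrow> f x y \<in> carrier R"
  shows "finsum R (\<lambda>x. finsum R (f x) B) A = finsum R (\<lambda>y. finsum R (\<lambda>x. f x y) A) B"
  using assms(1,3)
proof (induction A rule: finite_induct)
  case empty
  then show ?case by simp
next
  case (insert a A)
  have "finsum R (\<lambda>y. finsum R (\<lambda>x. f x y) (insert a A)) B
      = finsum R (\<lambda>y. f a y \<oplus> finsum R (\<lambda>x. f x y) A) B"
    using insert by (intro finsum_cong') (auto intro!: finsum_closed)
  also have "\<dots> = finsum R (f a) B \<oplus> finsum R (\<lambda>y. finsum R (\<lambda>x. f x y) A) B"
    using insert by (intro finsum_addf) (auto intro!: finsum_closed)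
  finally show ?case using insert by (simp add: Pi_iff)
qed

lemma group_algebra_ring:
  assumes "ring R" "group G" "finite (carrier G)"
  shows "ring (group_algebra R G)"
proof -
  interpret R: ring R by fact
  interpret G: group G by fact
  note fin = assms(3)
  let ?A = "group_algebra R G"
  have bij: "bij_betw (\<lambda>w. z \<otimes>\<^bsub>G\<^esub> w) (carrier G) (carrier G)" if "z \<in> carrier G" for z
    using that by (intro bij_betwI[where g = "\<lambda>y. inv\<^bsub>G\<^esub> z \<otimes>\<^bsub>G\<^esub> y"]) (auto simp: G.m_assoc[symmetric])
  have reindex: "finsum R f (carrier G) = finsum R (\<lambda>w. f (z \<otimes>\<^bsub>G\<^esub> w)) (carrier G)"
    if "z \<in> carrier G" "f \<in> carrier G \<rightarrow> carrier R" for z f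
    using R.finsum_reindex[of f "\<lambda>w. z \<otimes>\<^bsub>G\<^esub> w" "carrier G"] bij[OF that(1)] that
    by (simp add: bij_betw_def)
  have delta: "finsum R (\<lambda>y. if y = z then f y else \<zero>\<^bsub>R\<^esub>) (carrier G) = f z"
    if "z \<in> carrier G" "f \<in> carrier G \<rightarrow> carrier R" for z f
    using R.add.finprod_singleton_swap[of z "carrier G" f] that fin by (simp add: finsum_def)
  have conv_closed: "finsum R (\<lambda>y. f y \<otimes>\<^bsub>R\<^esub> h (inv\<^bsub>G\<^esub> y \<otimes>\<^bsub>G\<^esub> x)) (carrier G) \<in> carrier R"
    if "f \<in> carrier G \<rightarrow> carrier R" "h \<in> carrier G \<rightarrow> carrier R" "x \<in> carrier G" for f h x
    using that by (intro R.finsum_closed) (auto simp: Pi_iff)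
  show ?thesis
  proof (rule ringI)
    show "abelian_group ?A"
    proof (rule abelian_groupI)
      fix f assume f: "f \<in> carrier ?A"
      show "\<exists>h\<in>carrier ?A. h \<oplus>\<^bsub>?A\<^esub> f = \<zero>\<^bsub>?A\<^esub>"
        by (rule bexI[of _ "\<lambda>x\<in>carrier G. \<ominus>\<^bsub>R\<^esub> f x"])
          (use f in \<open>auto simp: group_algebra_def PiE_iff R.l_neg fun_eq_iff\<close>)
    qed (auto simp: group_algebra_def PiE_iff R.a_ac fun_eq_iff extensional_def)
    show "monoid ?A"
    proof (rule monoidI)
      fix f g assume "f \<in> carrier ?A" "g \<in> carrier ?A"
      then show "f \<otimes>\<^bsub>?A\<^esub> g \<in> carrier ?A"
        by (auto simp: group_algebra_def PiE_def intro!: conv_closed)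
    next
      show "\<one>\<^bsub>?A\<^esub> \<in> carrier ?A" by (auto simp: group_algebra_def)
    next
      fix f assume "f \<in> carrier ?A"
      then have f: "f \<in> carrier G \<rightarrow> carrier R" "f \<in> extensional (carrier G)"
        by (auto simp: group_algebra_def PiE_def)
      have "finsum R (\<lambda>y. (if y = \<one>\<^bsub>G\<^esub> then \<one>\<^bsub>R\<^esub> else \<zero>\<^bsub>R\<^esub>) \<otimes>\<^bsub>R\<^esub> f (inv\<^bsub>G\<^esub> y \<otimes>\<^bsub>G\<^esub> x)) (carrier G) = f x"
        if "x \<in> carrier G" for x
      proof -
        have "finsum R (\<lambda>y. (if y = \<one>\<^bsub>G\<^esub> then \<one>\<^bsub>R\<^esub> else \<zero>\<^bsub>R\<^esub>) \<otimes>\<^bsub>R\<^esub> f (inv\<^bsub>G\<^esub> y \<otimes>\<^bsub>G\<^esub> x)) (carrier G)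
          = finsum R (\<lambda>y. if y = \<one>\<^bsub>G\<^esub> then f (inv\<^bsub>G\<^esub> y \<otimes>\<^bsub>G\<^esub> x) else \<zero>\<^bsub>R\<^esub>) (carrier G)"
          using f that by (intro R.finsum_cong') (auto simp: Pi_iff)
        also have "\<dots> = f x" using f that by (subst delta) (auto simp: Pi_iff)
        finally show ?thesis .
      qed
      then show "\<one>\<^bsub>?A\<^esub> \<otimes>\<^bsub>?A\<^esub> f = f"
        using f by (auto simp: group_algebra_def fun_eq_iff extensional_def Pi_iff
            cong: R.finsum_cong)
      have "finsum R (\<lambda>y. f y \<otimes>\<^bsub>R\<^esub> (if inv\<^bsub>G\<^esub> y \<otimes>\<^bsub>G\<^esub> x = \<one>\<^bsub>G\<^esub> then \<one>\<^bsub>R\<^esub> else \<zero>\<^bsub>R\<^esub>)) (carrier G) = f x"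
        if x: "x \<in> carrier G" for x
      proof -
        have eq: "inv\<^bsub>G\<^esub> y \<otimes>\<^bsub>G\<^esub> x = \<one>\<^bsub>G\<^esub> \<longleftrightarrow> y = x" if "y \<in> carrier G" for y
          using that x by (metis G.inv_closed G.inv_inv G.inv_equality G.l_inv)
        have "finsum R (\<lambda>y. f y \<otimes>\<^bsub>R\<^esub> (if inv\<^bsub>G\<^esub> y \<otimes>\<^bsub>G\<^esub> x = \<one>\<^bsub>G\<^esub> then \<one>\<^bsub>R\<^esub> else \<zero>\<^bsub>R\<^esub>)) (carrier G)
          = finsum R (\<lambda>y. if y = x then f y else \<zero>\<^bsub>R\<^esub>) (carrier G)"
          using f x by (intro R.finsum_cong') (auto simp: Pi_iff eq)
        also have "\<dots> = f x" using f x by (subst delta) (auto simp: Pi_iff)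
        finally show ?thesis .
      qed
      then show "f \<otimes>\<^bsub>?A\<^esub> \<one>\<^bsub>?A\<^esub> = f"
        using f by (auto simp: group_algebra_def fun_eq_iff extensional_def Pi_iff
            cong: R.finsum_cong)
    next
      fix f g h assume "f \<in> carrier ?A" "g \<in> carrier ?A" "h \<in> carrier ?A"
      then have fgh: "f \<in> carrier G \<rightarrow> carrier R" "g \<in> carrier G \<rightarrow> carrier R"
          "h \<in> carrier G \<rightarrow> carrier R"
        by (auto simp: group_algebra_def PiE_def)
      have [simp]: "f x \<in> carrier R" "g x \<in> carrier R" "h x \<in> carrier R"
        if "x \<in> carrier G" for x using fgh that by auto
      have "finsum R (\<lambda>y. finsum R (\<lambda>z. f z \<otimes>\<^bsub>R\<^esub> g (inv\<^bsub>G\<^esub> z \<otimes>\<^bsub>G\<^esub> y)) (carrier G)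
                \<otimes>\<^bsub>R\<^esub> h (inv\<^bsub>G\<^esub> y \<otimes>\<^bsub>G\<^esub> x)) (carrier G)
          = finsum R (\<lambda>z. f z \<otimes>\<^bsub>R\<^esub> finsum R (\<lambda>w. g w \<otimes>\<^bsub>R\<^esub>
                h (inv\<^bsub>G\<^esub> w \<otimes>\<^bsub>G\<^esub> (inv\<^bsub>G\<^esub> z \<otimes>\<^bsub>G\<^esub> x))) (carrier G)) (carrier G)"
        if x: "x \<in> carrier G" for x
      proof -
        have "finsum R (\<lambda>y. finsum R (\<lambda>z. f z \<otimes>\<^bsub>R\<^esub> g (inv\<^bsub>G\<^esub> z \<otimes>\<^bsub>G\<^esub> y)) (carrier G)
                \<otimes>\<^bsub>R\<^esub> h (inv\<^bsub>G\<^esub> y \<otimes>\<^bsub>G\<^esub> x)) (carrier G)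
          = finsum R (\<lambda>y. finsum R (\<lambda>z. f z \<otimes>\<^bsub>R\<^esub> g (inv\<^bsub>G\<^esub> z \<otimes>\<^bsub>G\<^esub> y)
                \<otimes>\<^bsub>R\<^esub> h (inv\<^bsub>G\<^esub> y \<otimes>\<^bsub>G\<^esub> x)) (carrier G)) (carrier G)"
          using x fin by (intro R.finsum_cong') (auto simp: R.finsum_ldistr intro!: R.finsum_closed)
        also have "\<dots> = finsum R (\<lambda>z. finsum R (\<lambda>y. f z \<otimes>\<^bsub>R\<^esub> g (inv\<^bsub>G\<^esub> z \<otimes>\<^bsub>G\<^esub> y)
                \<otimes>\<^bsub>R\<^esub> h (inv\<^bsub>G\<^esub> y \<otimes>\<^bsub>G\<^esub> x)) (carrier G)) (carrier G)"
          using x fin by (intro R.finsum_swap) auto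
        also have "\<dots> = finsum R (\<lambda>z. f z \<otimes>\<^bsub>R\<^esub> finsum R (\<lambda>w. g w \<otimes>\<^bsub>R\<^esub>
                h (inv\<^bsub>G\<^esub> w \<otimes>\<^bsub>G\<^esub> (inv\<^bsub>G\<^esub> z \<otimes>\<^bsub>G\<^esub> x))) (carrier G)) (carrier G)"
        proof (intro R.finsum_cong' refl)
          fix z assume z: "z \<in> carrier G"
          have "finsum R (\<lambda>y. f z \<otimes>\<^bsub>R\<^esub> g (inv\<^bsub>G\<^esub> z \<otimes>\<^bsub>G\<^esub> y) \<otimes>\<^bsub>R\<^esub> h (inv\<^bsub>G\<^esub> y \<otimes>\<^bsub>G\<^esub> x)) (carrier G)
            = finsum R (\<lambda>w. f z \<otimes>\<^bsub>R\<^esub> g (inv\<^bsub>G\<^esub> z \<otimes>\<^bsub>G\<^esub> (z \<otimes>\<^bsub>G\<^esub> w))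
                \<otimes>\<^bsub>R\<^esub> h (inv\<^bsub>G\<^esub> (z \<otimes>\<^bsub>G\<^esub> w) \<otimes>\<^bsub>G\<^esub> x)) (carrier G)"
            using x z by (intro reindex) auto
          also have "\<dots> = finsum R (\<lambda>w. f z \<otimes>\<^bsub>R\<^esub> (g w \<otimes>\<^bsub>R\<^esub>
                h (inv\<^bsub>G\<^esub> w \<otimes>\<^bsub>G\<^esub> (inv\<^bsub>G\<^esub> z \<otimes>\<^bsub>G\<^esub> x)))) (carrier G)"
            using x z by (intro R.finsum_cong')
              (auto simp: G.inv_mult_group G.m_assoc R.m_assoc G.m_assoc[symmetric, of "inv\<^bsub>G\<^esub> z" z])
          also have "\<dots> = f z \<otimes>\<^bsub>R\<^esub> finsum R (\<lambda>w. g w \<otimes>\<^bsub>R\<^esub>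
                h (inv\<^bsub>G\<^esub> w \<otimes>\<^bsub>G\<^esub> (inv\<^bsub>G\<^esub> z \<otimes>\<^bsub>G\<^esub> x))) (carrier G)"
            using x z fin by (intro R.finsum_rdistr[symmetric]) auto
          finally show "finsum R (\<lambda>y. f z \<otimes>\<^bsub>R\<^esub> g (inv\<^bsub>G\<^esub> z \<otimes>\<^bsub>G\<^esub> y) \<otimes>\<^bsub>R\<^esub> h (inv\<^bsub>G\<^esub> y \<otimes>\<^bsub>G\<^esub> x)) (carrier G)
            = f z \<otimes>\<^bsub>R\<^esub> finsum R (\<lambda>w. g w \<otimes>\<^bsub>R\<^esub>
                h (inv\<^bsub>G\<^esub> w \<otimes>\<^bsub>G\<^esub> (inv\<^bsub>G\<^esub> z \<otimes>\<^bsub>G\<^esub> x))) (carrier G)" .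
        qed (use x in \<open>auto intro!: R.m_closed R.finsum_closed\<close>)
        finally show ?thesis .
      qed
      then show "f \<otimes>\<^bsub>?A\<^esub> g \<otimes>\<^bsub>?A\<^esub> h = f \<otimes>\<^bsub>?A\<^esub> (g \<otimes>\<^bsub>?A\<^esub> h)"
        using fgh by (simp add: group_algebra_def fun_eq_iff Pi_iff cong: R.finsum_cong)
    qed
    fix f g h assume "f \<in> carrier ?A" "g \<in> carrier ?A" "h \<in> carrier ?A"
    then have fgh: "f \<in> carrier G \<rightarrow> carrier R" "g \<in> carrier G \<rightarrow> carrier R"
        "h \<in> carrier G \<rightarrow> carrier R"
      by (auto simp: group_algebra_def PiE_def)
    have [simp]: "f x \<in> carrier R" "g x \<in> carrier R" "h x \<in> carrier R"
      if "x \<in> carrier G" for x using fgh that by auto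
    have "finsum R (\<lambda>y. (f y \<oplus>\<^bsub>R\<^esub> g y) \<otimes>\<^bsub>R\<^esub> h (inv\<^bsub>G\<^esub> y \<otimes>\<^bsub>G\<^esub> x)) (carrier G)
        = finsum R (\<lambda>y. f y \<otimes>\<^bsub>R\<^esub> h (inv\<^bsub>G\<^esub> y \<otimes>\<^bsub>G\<^esub> x)) (carrier G)
          \<oplus>\<^bsub>R\<^esub> finsum R (\<lambda>y. g y \<otimes>\<^bsub>R\<^esub> h (inv\<^bsub>G\<^esub> y \<otimes>\<^bsub>G\<^esub> x)) (carrier G)"
      if "x \<in> carrier G" for x
      using that by (simp add: R.l_distr R.finsum_addf Pi_iff cong: R.finsum_cong)
    then show "(f \<oplus>\<^bsub>?A\<^esub> g) \<otimes>\<^bsub>?A\<^esub> h = f \<otimes>\<^bsub>?A\<^esub> h \<oplus>\<^bsub>?A\<^esub> g \<otimes>\<^bsub>?A\<^esub> h"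
      using fgh by (simp add: group_algebra_def fun_eq_iff Pi_iff cong: R.finsum_cong)
    have "finsum R (\<lambda>y. h y \<otimes>\<^bsub>R\<^esub> (f (inv\<^bsub>G\<^esub> y \<otimes>\<^bsub>G\<^esub> x) \<oplus>\<^bsub>R\<^esub> g (inv\<^bsub>G\<^esub> y \<otimes>\<^bsub>G\<^esub> x))) (carrier G)
        = finsum R (\<lambda>y. h y \<otimes>\<^bsub>R\<^esub> f (inv\<^bsub>G\<^esub> y \<otimes>\<^bsub>G\<^esub> x)) (carrier G)
          \<oplus>\<^bsub>R\<^esub> finsum R (\<lambda>y. h y \<otimes>\<^bsub>R\<^esub> g (inv\<^bsub>G\<^esub> y \<otimes>\<^bsub>G\<^esub> x)) (carrier G)"
      if "x \<in> carrier G" for x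
      using that by (simp add: R.r_distr R.finsum_addf Pi_iff cong: R.finsum_cong)
    then show "h \<otimes>\<^bsub>?A\<^esub> (f \<oplus>\<^bsub>?A\<^esub> g) = h \<otimes>\<^bsub>?A\<^esub> f \<oplus>\<^bsub>?A\<^esub> h \<otimes>\<^bsub>?A\<^esub> g"
      using fgh by (simp add: group_algebra_def fun_eq_iff Pi_iff cong: R.finsum_cong)
  qed
qed

text \<open>The locales \<open>ideal\<close> and \<open>maximalideal\<close> of the library are about two-sided ideals, so
  the one-sided notions needed for the Jacobson radical of a noncommutative ring are
  introduced here.\<close>

definition left_ideal :: "'a set \<Rightarrow> ('a, 'b) ring_scheme \<Rightarrow> bool" where
  "left_ideal I R \<longleftrightarrow>
     additive_subgroup I R \<and> (\<forall>x\<in>carrier R. \<forall>a\<in>I. x \<otimes>\<^bsub>R\<^esub> a \<in> I)"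

definition maximal_left_ideal :: "'a set \<Rightarrow> ('a, 'b) ring_scheme \<Rightarrow> bool" where
  "maximal_left_ideal I R \<longleftrightarrow>
     left_ideal I R \<and> I \<noteq> carrier R \<and>
     (\<forall>J. left_ideal J R \<and> I \<subseteq> J \<longrightarrow> J = I \<or> J = carrier R)"

definition jacobson_radical :: "('a, 'b) ring_scheme \<Rightarrow> 'a set" where
  "jacobson_radical R = carrier R \<inter> \<Inter>{I. maximal_left_ideal I R}"

text \<open>Powers of ideals are powers in \<open>ideals_set R\<close>, whose multiplication is the ideal
  product; the zeroth power is the whole ring.\<close>

definition loewy_length :: "('a, 'b) ring_scheme \<Rightarrow> nat" where
  "loewy_length R = (LEAST t. jacobson_radical R [^]\<^bsub>ideals_set R\<^esub> t = {\<zero>\<^bsub>R\<^esub>})"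

end

theory Submission
  imports Defs "HOL-Library.Sublist"
begin

text \<open>
  If \<open>J\<^sup>L = 0\<close> and \<open>g\<^sub>1, \<dots>, g\<^sub>L\<close> are given, then \<open>(1 - g\<^sub>1) \<cdots> (1 - g\<^sub>L) = 0\<close>; comparing
  coefficients of \<open>1\<close> shows that some nonempty subsequence has product one, so \<open>D(G) \<le> L(G)\<close>.
  Hence it suffices to find \<open>n\<close> such that \<open>J\<^bsup>n+1\<^esup> = 0\<close> and there is a product-one free
  sequence of length \<open>n\<close>. Here \<open>n = (p\<^bsup>\<alpha>\<^esup> - 1) + (p\<^bsup>\<beta>\<^esup> - 1) + 2(p\<^bsup>\<sigma>\<^esup> - 1)\<close> with \<open>o(c) = p\<^bsup>\<sigma>\<^esup>\<close>,
  where \<open>\<sigma> = 1\<close> in cases (1) and (3) and \<open>c = 1\<close>, \<open>\<sigma> = 0\<close> in case (2).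

  For the vanishing, the span of the monomials \<open>(b - 1)\<^sup>j (a - 1)\<^sup>i (c - 1)\<^sup>k\<close> with
  \<open>j + i + 2k \<ge> m\<close> is mapped by right multiplication with \<open>g - 1\<close> into the one for \<open>m + 1\<close>,
  because conjugation by \<open>b\<close> changes \<open>a - 1\<close> and \<open>c - 1\<close> only by terms of higher weight.

  For the sequence, take \<open>b\<close> repeated \<open>p\<^bsup>\<beta>\<^esup> - 1\<close> times and \<open>a\<close> repeated \<open>p\<^bsup>\<alpha>\<^esup> - 1\<close> times; if
  \<open>\<sigma> = 1\<close>, insert between them \<open>p - 1\<close> copies each of two elements \<open>g1 = b\<^sup>t a c\<^sup>h\<close> and
  \<open>g2 = b a c\<^sup>q\<close>. The exponent of \<open>c\<close> in a subproduct is a binary quadratic form modulo \<open>p\<close> in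
  the numbers of copies used of \<open>g1\<close> and \<open>g2\<close>, and \<open>t, h, q\<close> can be chosen to make it
  anisotropic.
\<close>


section \<open>Subsequences and index sets\<close>

lemma set_subseq: "subseq ys gs \<Longrightarrow> set ys \<subseteq> set gs"
  by (auto simp: subseq_conv_nths dest: in_set_nthsD)

text \<open>Bridge from the index sets in \<open>davenport_constant\<close> to
  \<open>subseq\<close>, which suits induction on lists. Positions beyond the end of the list select
  nothing, so \<open>N\<close> can be cut down to valid positions.\<close>

lemma nonempty_nths_iff_subseq:
  "(\<exists>I. I \<noteq> {} \<and> I \<subseteq> {..<length gs} \<and> P (nths gs I)) \<longleftrightarrow> (\<exists>ys. subseq ys gs \<and> ys \<noteq> [] \<and> P ys)"
proof (intro iffI; elim exE conjE)
  fix I assume I: "I \<subseteq> {..<length gs}" "P (nths gs I)" and ne: "I \<noteq> {}"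
  have "{i. i < length gs \<and> i \<in> I} = I" using I by auto
  then have "length (nths gs I) > 0"
    using ne I finite_subset[OF I(1)] by (simp add: length_nths card_gt_0_iff)
  then show "\<exists>ys. subseq ys gs \<and> ys \<noteq> [] \<and> P ys"
    using I by (intro exI[of _ "nths gs I"]) (auto simp: subseq_conv_nths)
next
  fix ys assume ys: "subseq ys gs" "ys \<noteq> []" "P ys"
  then obtain N where N: "ys = nths gs N" by (auto simp: subseq_conv_nths)
  have "nths gs (N \<inter> {..<length gs}) = nths gs N"
    unfolding nths_def by (intro arg_cong[where f = "map fst"] filter_cong) (auto dest: set_zip_rightD)
  then show "\<exists>I. I \<noteq> {} \<and> I \<subseteq> {..<length gs} \<and> P (nths gs I)"
    using ys N by (intro exI[of _ "N \<inter> {..<length gs}"]) (auto intro: ccontr)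
qed

lemma subseq_replicate: "subseq ys (replicate n x) \<Longrightarrow> \<exists>k\<le>n. ys = replicate k x"
proof (induction n arbitrary: ys)
  case (Suc n)
  then show ?case
  proof (cases ys)
    case (Cons y zs)
    show ?thesis
    proof (cases "y = x")
      case True
      then have "subseq zs (replicate n x)" using Suc.prems Cons by simp
      then show ?thesis using Suc.IH True Cons by (metis Suc_le_mono replicate_Suc)
    next
      case False
      then have "subseq ys (replicate n x)" using Suc.prems Cons by simp
      then show ?thesis using Suc.IH le_SucI by blast
    qed
  qed auto
qed auto

lemma davenport_constant_subseq:
  "davenport_constant G = (LEAST k. 0 < k \<and>
     (\<forall>gs. length gs = k \<and> set gs \<subseteq> carrier G \<longrightarrow>
        (\<exists>ys. subseq ys gs \<and> ys \<noteq> [] \<and> foldr (\<otimes>\<^bsub>G\<^esub>) ys \<one>\<^bsub>G\<^esub> = \<one>\<^bsub>G\<^esub>)))"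
  unfolding davenport_constant_def nonempty_nths_iff_subseq[symmetric]
  by (intro arg_cong[where f = Least] ext) blast

subsection \<open>Additive spans and the Frobenius map\<close>

context ring
begin

lemma mult_ideals_set: "I \<otimes>\<^bsub>ideals_set R\<^esub> J = ideal_prod R I J"
  by (simp add: ideals_set_def)

lemma one_ideals_set: "\<one>\<^bsub>ideals_set R\<^esub> = carrier R"
  by (simp add: ideals_set_def)

text \<open>A generated additive subgroup is enough here: in characteristic p it is the span over
  the prime field.\<close>

definition add_span :: "'a set \<Rightarrow> 'a set" where
  "add_span S = generate (add_monoid R) S"

lemma add_span_incl: "x \<in> S \<Longrightarrow> x \<in> add_span S"
  by (simp add: add_span_def generate.incl)

lemma add_span_subgroup: "S \<subseteq> carrier R \<Longrightarrow> additive_subgroup (add_span S) R"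
  unfolding add_span_def by (intro additive_subgroup.intro add.generate_is_subgroup)

lemma add_span_minimal: "S \<subseteq> H \<Longrightarrow> additive_subgroup H R \<Longrightarrow> add_span S \<subseteq> H"
  unfolding add_span_def by (intro add.generate_subgroup_incl additive_subgroup.a_subgroup)

lemma add_span_mono: "S \<subseteq> T \<Longrightarrow> add_span S \<subseteq> add_span T"
  unfolding add_span_def by (rule add.mono_generate)

lemma add_span_carrier: "S \<subseteq> carrier R \<Longrightarrow> add_span S \<subseteq> carrier R"
  unfolding add_span_def by (rule add.generate_incl)

lemma additive_subgroup_minus:
  assumes "additive_subgroup H R" "x \<in> H" "y \<in> H"
  shows "x \<ominus> y \<in> H"
proof -
  interpret additive_subgroup H R by fact
  show ?thesis using assms by (simp add: minus_eq)
qed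

lemma add_minus_cancel: "x \<in> carrier R \<Longrightarrow> y \<in> carrier R \<Longrightarrow> (x \<oplus> y) \<ominus> x = y"
  by (simp add: minus_eq a_comm[of x] a_assoc r_neg)

text \<open>The elements with image in \<open>H\<close> form an additive subgroup containing
  \<open>S\<close>, hence its span. Containments of spans can thereby be checked on
  generators.\<close>

lemma add_span_map:
  assumes S: "S \<subseteq> carrier R" and H: "additive_subgroup H R"
    and f: "\<And>x. x \<in> carrier R \<Longrightarrow> f x \<in> carrier R"
    and add: "\<And>x y. x \<in> carrier R \<Longrightarrow> y \<in> carrier R \<Longrightarrow> f (x \<oplus> y) = f x \<oplus> f y"
    and gen: "\<And>x. x \<in> S \<Longrightarrow> f x \<in> H" and x: "x \<in> add_span S"
  shows "f x \<in> H"
proof -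
  interpret H: additive_subgroup H R by fact
  have f0: "f \<zero> = \<zero>"
    using add[of \<zero> \<zero>] f[of \<zero>] by (metis add.l_cancel_one' l_zero zero_closed)
  have "add_span S \<subseteq> {x \<in> carrier R. f x \<in> H}"
  proof (rule add_span_minimal)
    show "S \<subseteq> {x \<in> carrier R. f x \<in> H}" using S gen by auto
    have "f (\<ominus> x) = \<ominus> f x" if "x \<in> carrier R" for x
      using add[of "\<ominus> x" x] that f0 f by (simp add: l_neg minus_equality)
    then show "additive_subgroup {x \<in> carrier R. f x \<in> H} R"
      using f0 add by (auto intro!: additive_subgroup.intro add.subgroupI simp flip: a_inv_def)
  qed
  then show ?thesis using x by auto
qed

lemma add_span_mult:
  assumes S: "S \<subseteq> carrier R" and T: "T \<subseteq> carrier R" and H: "additive_subgroup H R"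
    and gen: "\<And>x y. x \<in> S \<Longrightarrow> y \<in> T \<Longrightarrow> x \<otimes> y \<in> H"
    and x: "x \<in> add_span S" and y: "y \<in> add_span T"
  shows "x \<otimes> y \<in> H"
proof -
  have yc: "y \<in> carrier R" using y T add_span_carrier by blast
  show ?thesis
  proof (rule add_span_map[where f = "\<lambda>x. x \<otimes> y", OF S H _ _ _ x])
    fix x assume x: "x \<in> S"
    show "x \<otimes> y \<in> H"
      by (rule add_span_map[OF T H _ _ _ y]) (use x S gen in \<open>auto simp: r_distr\<close>)
  qed (use yc in \<open>auto simp: l_distr\<close>)
qed

text \<open>The ring may be noncommutative, but \<one> commutes with \<open>x\<close>, so the usual
  induction by Pascal's rule goes through.\<close>

lemma binomial_one_plus:
  assumes x: "x \<in> carrier R"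
  shows "(\<one> \<oplus> x) [^] n = (\<Oplus>k\<in>{..n}. add_pow R (n choose k) (x [^] k))"
proof (induction n)
  case 0
  then show ?case using x by simp
next
  case (Suc n)
  let ?B = "\<Oplus>k\<in>{..n}. add_pow R (n choose k) (x [^] k)"
  have S: "?B \<in> carrier R" using x by (auto intro!: finsum_closed)
  \<comment> \<open>Splitting off the term for \<open>k = 0\<close> shifts the index by one, which
    is the form Pascal's rule needs.\<close>
  have "(\<Oplus>k\<in>{..Suc n}. add_pow R (Suc n choose k) (x [^] k))
      = (\<Oplus>k\<in>{..n}. add_pow R (n choose Suc k) (x [^] Suc k) \<oplus> add_pow R (n choose k) (x [^] Suc k)) \<oplus> \<one>"
    using x by (subst finsum_Suc2) (auto simp: add.nat_pow_mult add.commute intro!: finsum_cong')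
  also have "\<dots> = (\<Oplus>k\<in>{..n}. add_pow R (n choose Suc k) (x [^] Suc k)) \<oplus> \<one> \<oplus> (\<Oplus>k\<in>{..n}. add_pow R (n choose k) (x [^] Suc k))"
    using x by (subst finsum_addf) (auto simp: a_ac finsum_closed Pi_iff simp del: nat_pow_Suc)
  also have "(\<Oplus>k\<in>{..n}. add_pow R (n choose Suc k) (x [^] Suc k)) \<oplus> \<one> = (\<Oplus>k\<in>{..Suc n}. add_pow R (n choose k) (x [^] k))"
    using x by (subst finsum_Suc2) auto
  \<comment> \<open>The extra term has coefficient \<open>n choose Suc n = 0\<close>.\<close>
  also have "\<dots> = ?B" using x by (simp add: finsum_closed Pi_iff binomial_eq_0)
  also have "(\<Oplus>k\<in>{..n}. add_pow R (n choose k) (x [^] Suc k)) = ?B \<otimes> x"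
    using x by (subst finsum_ldistr) (auto simp: add_pow_ldistr intro!: finsum_cong')
  finally show ?case using Suc S x by (simp add: r_distr)
qed

text \<open>The prime p divides every inner binomial coefficient, so only the two outer terms of the
  binomial sum survive; iteration gives the power p^n.\<close>

lemma frobenius_one_plus:
  assumes p: "Factorial_Ring.prime (p :: nat)" and char: "\<And>y. y \<in> carrier R \<Longrightarrow> add_pow R (p) y = \<zero>"
    and x: "x \<in> carrier R"
  shows "(\<one> \<oplus> x) [^] (p ^ n) = \<one> \<oplus> x [^] (p ^ n)"
  using x
proof (induction n arbitrary: x)
  case 0
  then show ?case by simp
next
  case (Suc n)
  have p0: "p > 0" using p prime_gt_0_nat by blast
  have "(\<one> \<oplus> y) [^] p = \<one> \<oplus> y [^] p" if y: "y \<in> carrier R" for y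
  proof -
    have vanish: "add_pow R (p choose Suc k) (y [^] Suc k) = \<zero>" if "Suc k < p" for k
    proof -
      have "p dvd p choose Suc k" using p that by (intro dvd_choose_prime) auto
      then obtain m where "p choose Suc k = p * m" by (auto simp: dvd_def)
      then show ?thesis using char[of "y [^] Suc k"] y
        by (metis add.nat_pow_one add.nat_pow_pow nat_pow_closed)
    qed
    obtain q where q: "p = Suc q" using p0 by (cases p) auto
    have "(\<one> \<oplus> y) [^] p = (\<Oplus>k\<in>{..Suc q}. add_pow R (p choose k) (y [^] k))"
      using binomial_one_plus[OF y, of p] q by simp
    also have "\<dots> = y [^] p \<oplus> (\<Oplus>k\<in>{..q}. add_pow R (p choose k) (y [^] k))"
      using y q by (simp add: finsum_closed Pi_iff)
    also have "(\<Oplus>k\<in>{..q}. add_pow R (p choose k) (y [^] k)) = (\<Oplus>k\<in>{..q}. if k = 0 then \<one> else \<zero>)"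
    proof (rule finsum_cong')
      fix k assume "k \<in> {..q}"
      then show "add_pow R (p choose k) (y [^] k) = (if k = 0 then \<one> else \<zero>)"
        using y q vanish[of "k - 1"] by (cases "k = 0") (auto simp del: nat_pow_Suc binomial_Suc_Suc)
    qed auto
    also have "\<dots> = \<one>"
      using add.finprod_singleton_swap[of 0 "{..q}" "\<lambda>_. \<one>"] by simp
    finally show ?thesis using y by (simp add: a_comm)
  qed
  note frob = this
  have "(\<one> \<oplus> x) [^] (p ^ Suc n) = ((\<one> \<oplus> x) [^] (p ^ n)) [^] p"
    using Suc.prems by (simp add: nat_pow_pow mult.commute)
  also have "\<dots> = \<one> \<oplus> (x [^] (p ^ n)) [^] p" using Suc frob by simp
  finally show ?case using Suc.prems by (simp add: nat_pow_pow mult.commute)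
qed

end

subsection \<open>Radical and Davenport constant of a modular group ring\<close>

text \<open>Abstract form of the group algebra over the field with p elements, \<open>e\<close>
  being the embedding of the group. \<open>independent\<close> is the part of linear independence
  that lets the coefficient of the identity be read off.\<close>

locale modular_group_ring = ring R + G: group G
  for R :: "('r, 'm) ring_scheme" (structure) and G :: "('a, 'b) monoid_scheme" +
  fixes e :: "'a \<Rightarrow> 'r" and p :: nat
  assumes p_prime: "Factorial_Ring.prime p"
    and char: "x \<in> carrier R \<Longrightarrow> add_pow R p x = \<zero>"
    and e_closed [simp, intro]: "g \<in> carrier G \<Longrightarrow> e g \<in> carrier R"
    and e_mult: "g \<in> carrier G \<Longrightarrow> h \<in> carrier G \<Longrightarrow> e (g \<otimes>\<^bsub>G\<^esub> h) = e g \<otimes> e h"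
    and e_one [simp]: "e \<one>\<^bsub>G\<^esub> = \<one>"
    and spanning: "carrier R = add_span (e ` carrier G)"
    and independent: "\<one> \<notin> add_span (e ` (carrier G - {\<one>\<^bsub>G\<^esub>}))"
begin

definition augmentation :: "'r set" where
  "augmentation = add_span ((\<lambda>g. \<one> \<ominus> e g) ` carrier G)"

lemma augmentation_subgroup: "additive_subgroup augmentation R"
  unfolding augmentation_def by (intro add_span_subgroup) auto

lemma augmentation_carrier: "augmentation \<subseteq> carrier R"
  unfolding augmentation_def by (intro add_span_carrier) auto

lemma augmentation_gen: "g \<in> carrier G \<Longrightarrow> \<one> \<ominus> e g \<in> augmentation"
  unfolding augmentation_def by (intro add_span_incl) auto

lemma zero_neq_one: "\<one> \<noteq> \<zero>"
proof -
  have "additive_subgroup (add_span (e ` (carrier G - {\<one>\<^bsub>G\<^esub>}))) R"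
    by (intro add_span_subgroup) auto
  then show ?thesis using independent additive_subgroup.zero_closed by metis
qed

text \<open>On generators, g(1 - h) = (1 - gh) - (1 - g).\<close>

lemma augmentation_left_ideal: "left_ideal augmentation R"
proof -
  have "x \<otimes> d \<in> augmentation" if "x \<in> carrier R" "d \<in> augmentation" for x d
  proof (rule add_span_mult[OF _ _ augmentation_subgroup])
    show "x \<in> add_span (e ` carrier G)" using that spanning by simp
    show "d \<in> add_span ((\<lambda>g. \<one> \<ominus> e g) ` carrier G)" using that by (simp add: augmentation_def)
    fix u v assume "u \<in> e ` carrier G" "v \<in> (\<lambda>g. \<one> \<ominus> e g) ` carrier G"
    then obtain g h where gh: "g \<in> carrier G" "h \<in> carrier G" "u = e g" "v = \<one> \<ominus> e h" by auto
    have "(\<one> \<ominus> e g \<otimes> e h) \<ominus> (\<one> \<ominus> e g) = (\<one> \<oplus> \<ominus> \<one>) \<oplus> (e g \<ominus> e g \<otimes> e h)"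
      using gh by (simp only: minus_eq minus_add minus_minus a_ac e_closed one_closed m_closed a_inv_closed a_closed)
    then have "u \<otimes> v = (\<one> \<ominus> e (g \<otimes>\<^bsub>G\<^esub> h)) \<ominus> (\<one> \<ominus> e g)"
      using gh by (simp add: e_mult minus_eq r_distr r_minus r_neg)
    then show "u \<otimes> v \<in> augmentation"
      using gh by (auto intro!: additive_subgroup_minus augmentation_subgroup augmentation_gen)
  qed auto
  then show ?thesis by (auto simp: left_ideal_def augmentation_subgroup)
qed

text \<open>Each group element is congruent to 1 modulo the augmentation ideal, so sums and
  negatives of group elements are congruent to integers. This stands in for the quotient being the
  prime field.\<close>

lemma augmentation_decomp:
  assumes x: "x \<in> carrier R"
  shows "\<exists>k::int. x \<ominus> add_pow R k \<one> \<in> augmentation"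
proof -
  interpret A: additive_subgroup augmentation R by (rule augmentation_subgroup)
  let ?H = "{x \<in> carrier R. \<exists>k::int. x \<ominus> add_pow R k \<one> \<in> augmentation}"
  have "add_span (e ` carrier G) \<subseteq> ?H"
  proof (rule add_span_minimal)
    show "e ` carrier G \<subseteq> ?H"
    proof (intro subsetI, elim imageE)
      fix g y assume g: "g \<in> carrier G" "y = e g"
      have "e g \<ominus> add_pow R (1::int) \<one> = \<ominus> (\<one> \<ominus> e g)"
        using g by (simp add: minus_eq minus_add a_ac)
      then show "y \<in> ?H"
        using g augmentation_gen[of g] A.a_inv_closed[of "\<one> \<ominus> e g"] by (auto intro!: exI[of _ "1::int"])
    qed
    have "\<exists>l::int. \<ominus> y \<ominus> add_pow R l \<one> \<in> augmentation"
      if "y \<in> carrier R" "y \<ominus> add_pow R (k::int) \<one> \<in> augmentation" for y k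
    proof
      have "\<ominus> y \<ominus> add_pow R (-k) \<one> = \<ominus> (y \<ominus> add_pow R k \<one>)"
        using that by (simp add: minus_eq minus_add a_ac add.int_pow_neg)
      then show "\<ominus> y \<ominus> add_pow R (-k) \<one> \<in> augmentation" using that by simp
    qed
    moreover have "\<exists>m::int. (y \<oplus> z) \<ominus> add_pow R m \<one> \<in> augmentation"
      if "y \<in> carrier R" "z \<in> carrier R" "y \<ominus> add_pow R (k::int) \<one> \<in> augmentation"
        "z \<ominus> add_pow R (l::int) \<one> \<in> augmentation" for y z k l
    proof
      have "(y \<oplus> z) \<ominus> add_pow R (k + l) \<one> = (y \<ominus> add_pow R k \<one>) \<oplus> (z \<ominus> add_pow R l \<one>)"
        using that by (simp add: minus_eq minus_add a_ac add.int_pow_mult)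
      then show "(y \<oplus> z) \<ominus> add_pow R (k + l) \<one> \<in> augmentation" using that by simp
    qed
    moreover have "\<zero> \<ominus> add_pow R (0::int) \<one> \<in> augmentation" by (simp add: minus_eq add_pow_int_ge)
    ultimately show "additive_subgroup ?H R"
      by (intro additive_subgroup.intro add.subgroupI) (auto simp flip: a_inv_def)
  qed
  then show ?thesis using x spanning by auto
qed

text \<open>An element \<open>x\<close> outside the augmentation ideal is congruent to an integer k,
  and p does not divide k, since multiples of p vanish in the ring. A left ideal containing the
  augmentation ideal and \<open>x\<close> contains k, and Bezout turns k into 1.\<close>

lemma augmentation_maximal:
  assumes one: "\<one> \<notin> augmentation"
  shows "maximal_left_ideal augmentation R"
proof -
  have "J = carrier R" if J: "left_ideal J R" "augmentation \<subseteq> J" and ne: "J \<noteq> augmentation" for J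
  proof -
    interpret J: additive_subgroup J R using J by (simp add: left_ideal_def)
    obtain x where x: "x \<in> J" "x \<notin> augmentation" using J ne by auto
    then obtain k :: int where k: "x \<ominus> add_pow R k \<one> \<in> augmentation"
      using augmentation_decomp[of x] by auto
    have p1: "add_pow R (int p * l) \<one> = \<zero>" for l
    proof -
      have "add_pow R (int p) \<one> = \<zero>" using char[of \<one>] by (simp add: add_pow_int_ge)
      then show ?thesis using add.int_pow_pow[of \<one> l "int p"] by (simp add: mult.commute)
    qed
    have "\<not> int p dvd k"
    proof
      assume "int p dvd k"
      then have "add_pow R k \<one> = \<zero>" using p1 by auto
      then show False using k x by (simp add: minus_eq)
    qed
    then have "coprime (int p) k" using p_prime by (intro prime_imp_coprime) auto
    then obtain m l where ml: "m * k + l * int p = 1"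
      using bezout_int[of k "int p"] by (metis coprime_imp_gcd_eq_1 gcd.commute)
    have "add_pow R k \<one> = x \<ominus> (x \<ominus> add_pow R k \<one>)"
      using x by (simp add: minus_eq minus_add a_ac r_neg1 r_neg2 r_neg)
    also have "\<dots> \<in> J" by (rule additive_subgroup_minus[OF J.additive_subgroup_axioms]) (use x k J in auto)
    finally have kJ: "add_pow R k \<one> \<in> J" .
    have "\<one> = add_pow R (m * k + l * int p) \<one>" using ml by simp
    also have "\<dots> = add_pow R (m * k) \<one>"
      using p1[of l] by (simp add: add.int_pow_mult mult.commute[of l])
    also have "\<dots> = add_pow R m \<one> \<otimes> add_pow R k \<one>"
      by (simp add: add_pow_ldistr_int add.int_pow_pow mult.commute)
    also have "\<dots> \<in> J" using kJ J(1) by (simp add: left_ideal_def)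
    finally have "\<one> \<in> J" .
    then have "y \<in> J" if "y \<in> carrier R" for y using J(1) that unfolding left_ideal_def by (metis r_one)
    then show ?thesis using J.a_subset by auto
  qed
  then show ?thesis
    using one unfolding maximal_left_ideal_def by (auto simp: augmentation_left_ideal)
qed

text \<open>The witness is the geometric sum 1 + d + ... + d^(n-1). For nilpotent \<open>d\<close>
  it is a left inverse of 1 - d.\<close>

lemma one_minus_nilpotent_unit:
  assumes d: "d \<in> carrier R"
  shows "\<exists>y\<in>carrier R. y \<otimes> (\<one> \<ominus> d) = \<one> \<ominus> d [^] (n::nat)"
proof (induction n)
  case 0
  show ?case using d by (intro bexI[of _ \<zero>]) (auto simp: minus_eq r_neg)
next
  case (Suc n)
  then obtain y where y: "y \<in> carrier R" "y \<otimes> (\<one> \<ominus> d) = \<one> \<ominus> d [^] n" by auto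
  have "(y \<oplus> d [^] n) \<otimes> (\<one> \<ominus> d) = (\<one> \<ominus> d [^] n) \<oplus> d [^] n \<otimes> (\<one> \<ominus> d)"
    using y d by (simp add: l_distr)
  also have "\<dots> = \<one> \<ominus> d [^] Suc n"
    using d by (simp add: minus_eq r_distr r_minus a_ac r_neg2)
  finally show ?case using y d by blast
qed

text \<open>Such a \<open>W\<close> bounds the powers of the augmentation ideal from above: the n-th
  power lies in \<open>W n\<close>. A single vanishing \<open>W t\<close> therefore bounds the Loewy
  length.\<close>

definition filtration :: "(nat \<Rightarrow> 'r set) \<Rightarrow> bool" where
  "filtration W \<longleftrightarrow> W 0 = carrier R \<and> (\<forall>n. additive_subgroup (W n) R) \<and>
     (\<forall>n. \<forall>x\<in>W n. \<forall>g\<in>carrier G. x \<otimes> (\<one> \<ominus> e g) \<in> W (Suc n))"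

lemma filtration_mult:
  assumes W: "filtration W" and x: "x \<in> W n" and d: "d \<in> augmentation"
  shows "x \<otimes> d \<in> W (Suc n)"
proof -
  have sub: "additive_subgroup (W (Suc n)) R" using W by (auto simp: filtration_def)
  have xc: "x \<in> carrier R"
    using W x additive_subgroup.a_subset unfolding filtration_def by blast
  show ?thesis
    by (rule add_span_map[OF _ sub _ _ _ d[unfolded augmentation_def]])
      (use xc x W in \<open>auto simp: filtration_def r_distr\<close>)
qed

context
  fixes W t
  assumes W: "filtration W" and Wt: "W t = {\<zero>}"
begin

lemma augmentation_nilpotent:
  assumes d: "d \<in> augmentation"
  shows "d [^] t = \<zero>"
proof -
  have "d [^] n \<in> W n" for n
  proof (induction n)
    case 0
    then show ?case using W by (simp add: filtration_def)
  next
    case (Suc n)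
    then show ?case using filtration_mult[OF W _ d] by simp
  qed
  then show ?thesis using Wt by auto
qed

lemma one_notin_augmentation: "\<one> \<notin> augmentation"
  using augmentation_nilpotent[of \<one>] zero_neq_one by auto

text \<open>If a maximal left ideal M did not contain the augmentation ideal, their sum would be the
  whole ring, so 1 = m + d. Then m = 1 - d is left invertible because d is nilpotent, and M would be
  everything. As the augmentation ideal is itself maximal, it is the intersection.\<close>

lemma jacobson_radical_eq: "jacobson_radical R = augmentation"
proof -
  have "augmentation \<subseteq> M" if M: "maximal_left_ideal M R" for M
  proof -
    have Ml: "left_ideal M R" using M by (simp add: maximal_left_ideal_def)
    interpret M: additive_subgroup M R using Ml by (simp add: left_ideal_def)
    interpret A: additive_subgroup augmentation R by (rule augmentation_subgroup)
    define J where "J = set_add R M augmentation"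
    have J_iff: "z \<in> J \<longleftrightarrow> (\<exists>m\<in>M. \<exists>d\<in>augmentation. z = m \<oplus> d)" for z
      by (auto simp: J_def set_add_def')
    have J: "left_ideal J R"
      unfolding left_ideal_def
    proof (intro conjI ballI)
      show "additive_subgroup J R"
        unfolding J_def
        by (intro add_additive_subgroups M.additive_subgroup_axioms A.additive_subgroup_axioms)
      fix x a assume x: "x \<in> carrier R" and "a \<in> J"
      then obtain m d where md: "m \<in> M" "d \<in> augmentation" "a = m \<oplus> d" by (auto simp: J_iff)
      then have "x \<otimes> a = x \<otimes> m \<oplus> x \<otimes> d" using x by (simp add: r_distr)
      moreover have "x \<otimes> m \<in> M" "x \<otimes> d \<in> augmentation"
        using md x Ml augmentation_left_ideal by (auto simp: left_ideal_def)
      ultimately show "x \<otimes> a \<in> J" unfolding J_iff by blast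
    qed
    have MJ: "M \<subseteq> J"
    proof
      fix m assume "m \<in> M"
      then have "m = m \<oplus> \<zero>" by simp
      then show "m \<in> J" unfolding J_iff using \<open>m \<in> M\<close> A.zero_closed by blast
    qed
    have AJ: "augmentation \<subseteq> J"
    proof
      fix d assume "d \<in> augmentation"
      then have "d = \<zero> \<oplus> d" by simp
      then show "d \<in> J" unfolding J_iff using \<open>d \<in> augmentation\<close> M.zero_closed by blast
    qed
    have "J \<noteq> carrier R"
    proof
      assume "J = carrier R"
      then have "\<one> \<in> J" by simp
      then obtain m d where md: "m \<in> M" "d \<in> augmentation" "\<one> = m \<oplus> d"
        unfolding J_iff by blast
      then have m: "m = \<one> \<ominus> d" by (simp add: minus_eq a_assoc r_neg)
      obtain y where y: "y \<in> carrier R" "y \<otimes> m = \<one> \<ominus> d [^] t"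
        using one_minus_nilpotent_unit[of d t] md(2) m by auto
      then have "y \<otimes> m = \<one>" using augmentation_nilpotent[OF md(2)] by (simp add: minus_eq)
      then have one: "\<one> \<in> M" using Ml y(1) md(1) unfolding left_ideal_def by metis
      have "x \<in> M" if "x \<in> carrier R" for x using Ml one that unfolding left_ideal_def by (metis r_one)
      then have "M = carrier R" using M.a_subset by auto
      then show False using M by (simp add: maximal_left_ideal_def)
    qed
    moreover have "J = M \<or> J = carrier R" using M J MJ unfolding maximal_left_ideal_def by blast
    ultimately show ?thesis using AJ by simp
  qed
  moreover have "maximal_left_ideal augmentation R"
    by (rule augmentation_maximal[OF one_notin_augmentation])
  ultimately show ?thesis
    using augmentation_carrier by (auto simp: jacobson_radical_def)
qed

lemma jacobson_pow_subset: "jacobson_radical R [^]\<^bsub>ideals_set R\<^esub> n \<subseteq> W n"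
proof (induction n)
  case 0
  then show ?case using W by (simp add: one_ideals_set filtration_def)
next
  case (Suc n)
  have "x \<in> W (Suc n)" if "x \<in> ideal_prod R (jacobson_radical R [^]\<^bsub>ideals_set R\<^esub> n) augmentation" for x
    using that
  proof induction
    case (prod i j)
    then show ?case using Suc filtration_mult[OF W] by auto
  next
    case (sum s1 s2)
    have "additive_subgroup (W (Suc n)) R" using W by (auto simp: filtration_def)
    then show ?case using sum by (intro additive_subgroup.a_closed)
  qed
  then show ?case by (auto simp: mult_ideals_set jacobson_radical_eq)
qed

lemma jacobson_pow_list:
  assumes "set gs \<subseteq> carrier G"
  shows "foldr (\<otimes>) (map (\<lambda>g. \<one> \<ominus> e g) gs) \<one> \<in> jacobson_radical R [^]\<^bsub>ideals_set R\<^esub> length gs"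
  using assms
proof (induction gs rule: rev_induct)
  case Nil
  then show ?case by (simp add: one_ideals_set)
next
  case (snoc g gs)
  \<comment> \<open>Powers in \<open>ideals_set R\<close> grow on the right, hence the induction at
    the end of the list. There \<open>foldr\<close> starts from the last factor, which this identity
    pulls out.\<close>
  have *: "foldr (\<otimes>) xs y = foldr (\<otimes>) xs \<one> \<otimes> y" if "set xs \<subseteq> carrier R" "y \<in> carrier R" for xs y
  proof -
    have "foldr (\<otimes>) xs \<one> \<in> carrier R \<and> foldr (\<otimes>) xs y = foldr (\<otimes>) xs \<one> \<otimes> y"
      using that by (induction xs) (auto simp: m_assoc)
    then show ?thesis by simp
  qed
  have "foldr (\<otimes>) (map (\<lambda>g. \<one> \<ominus> e g) (gs @ [g])) \<one>
      = foldr (\<otimes>) (map (\<lambda>g. \<one> \<ominus> e g) gs) \<one> \<otimes> (\<one> \<ominus> e g)"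
    using snoc.prems *[of "map (\<lambda>g. \<one> \<ominus> e g) gs" "\<one> \<ominus> e g"] by auto
  then show ?case
    using snoc augmentation_gen[of g]
    by (auto simp: mult_ideals_set jacobson_radical_eq intro: ideal_prod.prod)
qed

lemma jacobson_pow_eq: "jacobson_radical R [^]\<^bsub>ideals_set R\<^esub> t = {\<zero>}"
proof -
  \<comment> \<open>Any list of length \<open>t\<close> would do: it shows that the power is
    nonempty, and \<open>W t\<close> leaves only zero.\<close>
  have "set (replicate t \<one>\<^bsub>G\<^esub>) \<subseteq> carrier G" by auto
  from jacobson_pow_list[OF this] show ?thesis using jacobson_pow_subset[of t] Wt by (auto simp del: map_replicate foldr_replicate)
qed

lemma loewy_length_le: "loewy_length R \<le> t"
  unfolding loewy_length_def by (intro Least_le jacobson_pow_eq)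

lemma loewy_length_pow: "jacobson_radical R [^]\<^bsub>ideals_set R\<^esub> loewy_length R = {\<zero>}"
  unfolding loewy_length_def by (rule LeastI, rule jacobson_pow_eq)

lemma loewy_length_pos: "loewy_length R > 0"
proof (rule ccontr)
  assume "\<not> loewy_length R > 0"
  then have "carrier R = {\<zero>}" using loewy_length_pow by (simp add: one_ideals_set)
  then show False using zero_neq_one by auto
qed

end

lemma foldr_G_closed: "set ys \<subseteq> carrier G \<Longrightarrow> foldr (\<otimes>\<^bsub>G\<^esub>) ys \<one>\<^bsub>G\<^esub> \<in> carrier G"
  by (induction ys) auto

text \<open>Multiplying out, the empty choice contributes 1 and every other term is, up to sign, a
  nonempty subproduct in the original order.\<close>

lemma list_prod_expand:
  assumes "set gs \<subseteq> carrier G"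
  shows "foldr (\<otimes>) (map (\<lambda>g. \<one> \<ominus> e g) gs) \<one> \<ominus> \<one>
    \<in> add_span (e ` {foldr (\<otimes>\<^bsub>G\<^esub>) ys \<one>\<^bsub>G\<^esub> | ys. subseq ys gs \<and> ys \<noteq> []})"
  using assms
proof (induction gs)
  case Nil
  then show ?case by (simp add: minus_eq r_neg add_span_def generate.one[of "add_monoid R", simplified])
next
  case (Cons g gs)
  let ?P = "\<lambda>gs. {foldr (\<otimes>\<^bsub>G\<^esub>) ys \<one>\<^bsub>G\<^esub> | ys. subseq ys gs \<and> ys \<noteq> []}"
  let ?u = "foldr (\<otimes>) (map (\<lambda>g. \<one> \<ominus> e g) gs) \<one>"
  have sub: "?P hs \<subseteq> carrier G" if "set hs \<subseteq> carrier G" for hs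
    using that by (auto intro!: foldr_G_closed dest!: set_subseq)
  have P: "?P (g # gs) \<subseteq> carrier G" "?P gs \<subseteq> carrier G" using sub Cons.prems by auto
  have g: "g \<in> carrier G" using Cons.prems by auto
  interpret S: additive_subgroup "add_span (e ` ?P (g # gs))" R
    using P by (intro add_span_subgroup) auto
  have u: "?u \<in> carrier R" using Cons.prems by (induction gs) auto
  have IH: "?u \<ominus> \<one> \<in> add_span (e ` ?P gs)" using Cons by auto
  have "?P gs \<subseteq> ?P (g # gs)" by (auto intro: list_emb_Cons)
  then have 1: "?u \<ominus> \<one> \<in> add_span (e ` ?P (g # gs))"
    using IH add_span_mono[of "e ` ?P gs" "e ` ?P (g # gs)"] by blast
  have 2: "e g \<in> add_span (e ` ?P (g # gs))"
    using g by (intro add_span_incl imageI) (auto intro!: exI[of _ "[g]"])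
  have 3: "e g \<otimes> (?u \<ominus> \<one>) \<in> add_span (e ` ?P (g # gs))"
  proof (rule add_span_map[OF _ S.additive_subgroup_axioms _ _ _ IH])
    fix x assume "x \<in> e ` ?P gs"
    then obtain ys where ys: "subseq ys gs" "ys \<noteq> []" "x = e (foldr (\<otimes>\<^bsub>G\<^esub>) ys \<one>\<^bsub>G\<^esub>)" by auto
    then have "foldr (\<otimes>\<^bsub>G\<^esub>) ys \<one>\<^bsub>G\<^esub> \<in> carrier G" using P(2) by blast
    then have "e g \<otimes> x = e (foldr (\<otimes>\<^bsub>G\<^esub>) (g # ys) \<one>\<^bsub>G\<^esub>)" using ys g by (simp add: e_mult)
    then show "e g \<otimes> x \<in> add_span (e ` ?P (g # gs))"
      using ys by (auto intro!: add_span_incl exI[of _ "g # ys"])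
  qed (use g P in \<open>auto simp: r_distr\<close>)
  \<comment> \<open>Each summand on the right lies in the span: the first omits g, the second is g
    alone, the third prefixes g to a nonempty choice.\<close>
  have "(\<one> \<ominus> e g) \<otimes> ?u \<ominus> \<one> = (?u \<ominus> \<one>) \<ominus> e g \<ominus> e g \<otimes> (?u \<ominus> \<one>)"
    using u g by (simp add: minus_eq l_distr r_distr r_minus l_minus minus_add a_ac r_neg2 r_neg1 r_neg)
  then show ?case
    using 1 2 3 additive_subgroup_minus[OF S.additive_subgroup_axioms] by simp
qed

text \<open>By \<open>list_prod_expand\<close> a vanishing product makes -1 a combination of
  nonempty subproducts. If none of these were the identity, \<open>independent\<close> would
  fail.\<close>

lemma subproduct_one:
  assumes gs: "set gs \<subseteq> carrier G"
    and zero: "foldr (\<otimes>) (map (\<lambda>g. \<one> \<ominus> e g) gs) \<one> = \<zero>"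
  shows "\<exists>ys. subseq ys gs \<and> ys \<noteq> [] \<and> foldr (\<otimes>\<^bsub>G\<^esub>) ys \<one>\<^bsub>G\<^esub> = \<one>\<^bsub>G\<^esub>"
proof (rule ccontr)
  assume neg: "\<not> ?thesis"
  let ?P = "{foldr (\<otimes>\<^bsub>G\<^esub>) ys \<one>\<^bsub>G\<^esub> | ys. subseq ys gs \<and> ys \<noteq> []}"
  have "?P \<subseteq> carrier G" using gs by (auto intro!: foldr_G_closed dest!: set_subseq)
  then have P: "?P \<subseteq> carrier G - {\<one>\<^bsub>G\<^esub>}" using neg by auto
  interpret S: additive_subgroup "add_span (e ` (carrier G - {\<one>\<^bsub>G\<^esub>}))" R
    by (intro add_span_subgroup) auto
  have "\<zero> \<ominus> \<one> \<in> add_span (e ` ?P)" using list_prod_expand[OF gs] zero by simp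
  then have "\<zero> \<ominus> \<one> \<in> add_span (e ` (carrier G - {\<one>\<^bsub>G\<^esub>}))"
    using add_span_mono[OF image_mono[OF P, of e]] by blast
  then have "\<one> \<in> add_span (e ` (carrier G - {\<one>\<^bsub>G\<^esub>}))"
    using S.a_inv_closed[of "\<zero> \<ominus> \<one>"] by (simp add: minus_eq)
  then show False using independent by simp
qed

text \<open>The chain n < D(G) \<le> L(G) \<le> n + 1 forces equality.\<close>

theorem davenport_eq_loewy:
  assumes W: "filtration W" and Wn: "W (Suc n) = {\<zero>}"
    and gs: "length gs = n" "set gs \<subseteq> carrier G"
    and free: "\<And>ys. subseq ys gs \<Longrightarrow> foldr (\<otimes>\<^bsub>G\<^esub>) ys \<one>\<^bsub>G\<^esub> = \<one>\<^bsub>G\<^esub> \<Longrightarrow> ys = []"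
  shows "davenport_constant G = loewy_length R"
proof -
  let ?Q = "\<lambda>k. 0 < k \<and> (\<forall>gs. length gs = k \<and> set gs \<subseteq> carrier G \<longrightarrow>
        (\<exists>ys. subseq ys gs \<and> ys \<noteq> [] \<and> foldr (\<otimes>\<^bsub>G\<^esub>) ys \<one>\<^bsub>G\<^esub> = \<one>\<^bsub>G\<^esub>))"
  have L: "?Q (loewy_length R)"
  proof (intro conjI allI impI)
    show "loewy_length R > 0" by (rule loewy_length_pos[OF W Wn])
    fix hs :: "'a list" assume hs: "length hs = loewy_length R \<and> set hs \<subseteq> carrier G"
    then have "foldr (\<otimes>) (map (\<lambda>g. \<one> \<ominus> e g) hs) \<one> = \<zero>"
      using jacobson_pow_list[OF W Wn, of hs] loewy_length_pow[OF W Wn] by auto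
    then show "\<exists>ys. subseq ys hs \<and> ys \<noteq> [] \<and> foldr (\<otimes>\<^bsub>G\<^esub>) ys \<one>\<^bsub>G\<^esub> = \<one>\<^bsub>G\<^esub>"
      using subproduct_one hs by blast
  qed
  \<comment> \<open>Prefixes of a product-one free sequence are product-one free, so no length up to
    \<open>n\<close> has the property.\<close>
  have "n < k" if k: "?Q k" for k
  proof (rule ccontr)
    assume "\<not> n < k"
    moreover have "set (take k gs) \<subseteq> carrier G" using gs set_take_subset by fast
    ultimately obtain ys where "subseq ys (take k gs)" "ys \<noteq> []" "foldr (\<otimes>\<^bsub>G\<^esub>) ys \<one>\<^bsub>G\<^esub> = \<one>\<^bsub>G\<^esub>"
      using k gs by (auto dest!: spec[of _ "take k gs"])
    moreover have "subseq (take k gs) gs"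
      by (metis append_take_drop_id list_emb_append2 subseq_order.refl subseq_rev_drop_many)
    ultimately show False using free subseq_order.trans by blast
  qed
  then have "loewy_length R \<le> k" if "?Q k" for k
    using loewy_length_le[OF W Wn] that by fastforce
  then show ?thesis
    unfolding davenport_constant_subseq using L by (intro Least_equality) auto
qed

end

subsection \<open>Bounding the Loewy length by a weight filtration\<close>

text \<open>One shape of relations for all three families. The factor p in the exponents of
  \<open>a\<close> pushes those corrections to weight at least p, hence at least 3.\<close>

locale three_generated = modular_group_ring R G e p
  for R :: "('r, 'm) ring_scheme" (structure) and G :: "('a, 'b) monoid_scheme" and e p +
  fixes a b c :: 'a and \<alpha> \<beta> \<sigma> u v w :: nat
  assumes p_ge_3: "p \<ge> 3"
    and gens [simp]: "a \<in> carrier G" "b \<in> carrier G" "c \<in> carrier G"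
    and pow_a: "a [^]\<^bsub>G\<^esub> (p ^ \<alpha>) = \<one>\<^bsub>G\<^esub>" and pow_b: "b [^]\<^bsub>G\<^esub> (p ^ \<beta>) = \<one>\<^bsub>G\<^esub>"
    and pow_c: "c [^]\<^bsub>G\<^esub> (p ^ \<sigma>) = \<one>\<^bsub>G\<^esub>"
    and comm: "a \<otimes>\<^bsub>G\<^esub> c = c \<otimes>\<^bsub>G\<^esub> a"
    and conj_a: "inv\<^bsub>G\<^esub> b \<otimes>\<^bsub>G\<^esub> a \<otimes>\<^bsub>G\<^esub> b = a \<otimes>\<^bsub>G\<^esub> (a [^]\<^bsub>G\<^esub> (p * u) \<otimes>\<^bsub>G\<^esub> c [^]\<^bsub>G\<^esub> v)"
    and conj_c: "inv\<^bsub>G\<^esub> b \<otimes>\<^bsub>G\<^esub> c \<otimes>\<^bsub>G\<^esub> b = c \<otimes>\<^bsub>G\<^esub> a [^]\<^bsub>G\<^esub> (p * w)"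
    and normal_form: "g \<in> carrier G \<Longrightarrow>
      \<exists>(k::nat) (i::nat) (j::nat). g = c [^]\<^bsub>G\<^esub> k \<otimes>\<^bsub>G\<^esub> a [^]\<^bsub>G\<^esub> i \<otimes>\<^bsub>G\<^esub> b [^]\<^bsub>G\<^esub> j"
begin

text \<open>The sign is opposite to that of the generators of \<open>augmentation\<close>, so that
  \<open>e g = \<one> \<oplus> diff g\<close> fits the Frobenius identity.\<close>

definition diff :: "'a \<Rightarrow> 'r" where "diff g = e g \<ominus> \<one>"

lemma diff_closed [simp, intro]: "g \<in> carrier G \<Longrightarrow> diff g \<in> carrier R"
  by (simp add: diff_def)

lemma e_diff: "g \<in> carrier G \<Longrightarrow> e g = \<one> \<oplus> diff g"
  by (simp add: diff_def minus_eq a_comm[of \<one>] a_assoc l_neg)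

lemma diff_mult:
  assumes "g \<in> carrier G" "h \<in> carrier G"
  shows "diff (g \<otimes>\<^bsub>G\<^esub> h) = diff g \<otimes> diff h \<oplus> diff g \<oplus> diff h"
proof -
  have "\<one> \<oplus> diff (g \<otimes>\<^bsub>G\<^esub> h) = (\<one> \<oplus> diff g) \<otimes> (\<one> \<oplus> diff h)"
    using assms by (simp add: e_mult flip: e_diff)
  also have "\<dots> = \<one> \<oplus> (diff g \<otimes> diff h \<oplus> diff g \<oplus> diff h)"
    using assms by (simp add: l_distr r_distr a_ac)
  finally show ?thesis using assms by simp
qed

lemma e_pow: "g \<in> carrier G \<Longrightarrow> e (g [^]\<^bsub>G\<^esub> (n::nat)) = e g [^] n"
  by (induction n) (auto simp: e_mult)

lemma diff_pow_prime_power: "g \<in> carrier G \<Longrightarrow> diff (g [^]\<^bsub>G\<^esub> (p ^ n)) = diff g [^] (p ^ n)"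
proof -
  assume g: "g \<in> carrier G"
  have "\<one> \<oplus> diff (g [^]\<^bsub>G\<^esub> (p ^ n)) = (\<one> \<oplus> diff g) [^] (p ^ n)"
    using g by (simp add: e_pow flip: e_diff)
  also have "\<dots> = \<one> \<oplus> diff g [^] (p ^ n)"
    using g by (intro frobenius_one_plus p_prime char) auto
  finally show ?thesis using g by simp
qed

lemma diff_one [simp]: "diff \<one>\<^bsub>G\<^esub> = \<zero>"
  by (simp add: diff_def minus_eq r_neg)

lemma diff_nilpotent:
  assumes "g \<in> carrier G" "g [^]\<^bsub>G\<^esub> (p ^ n) = \<one>\<^bsub>G\<^esub>" "p ^ n \<le> m"
  shows "diff g [^] m = \<zero>"
proof -
  have "diff g [^] (p ^ n) = \<zero>" using diff_pow_prime_power[of g n] assms by simp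
  then show ?thesis
    using nat_pow_mult[of "diff g" "p ^ n" "m - p ^ n"] assms by (metis diff_closed l_null le_add_diff_inverse nat_pow_closed)
qed

lemma diff_commute: "diff a \<otimes> diff c = diff c \<otimes> diff a"
proof -
  have "diff a \<otimes> diff c \<oplus> (diff a \<oplus> diff c) = diff c \<otimes> diff a \<oplus> (diff a \<oplus> diff c)"
    using diff_mult[of a c] diff_mult[of c a] by (simp add: comm a_ac)
  then show ?thesis by simp
qed

text \<open>\<open>diff a\<close> and \<open>diff b\<close> have weight \<open>1\<close>, \<open>diff c\<close> has weight \<open>2\<close>.\<close>

definition weight_span :: "nat \<Rightarrow> 'r set" where
  "weight_span n = add_span {diff a [^] i \<otimes> diff c [^] k | i k. n \<le> i + 2 * k}"

lemma weight_span_gen: "n \<le> i + 2 * k \<Longrightarrow> diff a [^] i \<otimes> diff c [^] k \<in> weight_span n"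
  unfolding weight_span_def by (intro add_span_incl) auto

lemma weight_span_subgroup: "additive_subgroup (weight_span n) R"
  unfolding weight_span_def by (intro add_span_subgroup) auto

lemma weight_span_carrier: "x \<in> weight_span n \<Longrightarrow> x \<in> carrier R"
  using additive_subgroup.a_subset[OF weight_span_subgroup] by blast

lemma weight_span_antimono: "m \<le> n \<Longrightarrow> weight_span n \<subseteq> weight_span m"
  unfolding weight_span_def by (intro add_span_mono) (blast intro: le_trans)

lemma weight_span_add: "x \<in> weight_span n \<Longrightarrow> y \<in> weight_span n \<Longrightarrow> x \<oplus> y \<in> weight_span n"
  using additive_subgroup.a_closed[OF weight_span_subgroup] .

lemma weight_span_mult:
  assumes "x \<in> weight_span m" "y \<in> weight_span n"
  shows "x \<otimes> y \<in> weight_span (m + n)"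
proof (rule add_span_mult[OF _ _ weight_span_subgroup _ assms[unfolded weight_span_def]])
  fix x y assume "x \<in> {diff a [^] i \<otimes> diff c [^] k | i k. m \<le> i + 2 * k}"
    and "y \<in> {diff a [^] i \<otimes> diff c [^] k | i k. n \<le> i + 2 * k}"
  then obtain i k i' k' where *: "m \<le> i + 2 * k" "n \<le> i' + 2 * k'"
    "x = diff a [^] i \<otimes> diff c [^] k" "y = diff a [^] i' \<otimes> diff c [^] k'" by blast
  have "diff c [^] k \<otimes> diff a [^] i' = diff a [^] i' \<otimes> diff c [^] k"
  proof -
    have "diff a [^] i' \<otimes> diff c = diff c \<otimes> diff a [^] i'"
      using diff_commute by (intro group_commutes_pow) auto
    then show ?thesis by (intro group_commutes_pow) auto
  qed
  then have "x \<otimes> y = diff a [^] i \<otimes> (diff a [^] i' \<otimes> diff c [^] k) \<otimes> diff c [^] k'"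
    using * by (simp add: m_assoc flip: m_assoc[of "diff c [^] k" "diff a [^] i'"])
  also have "\<dots> = diff a [^] (i + i') \<otimes> diff c [^] (k + k')"
    by (simp add: m_assoc flip: nat_pow_mult)
  finally show "x \<otimes> y \<in> weight_span (m + n)" using * by (auto intro: weight_span_gen)
qed auto

lemma one_in_weight_span: "\<one> \<in> weight_span 0"
  using weight_span_gen[of 0 0 0] by simp

lemma diff_a_in_weight_span: "diff a \<in> weight_span 1"
  using weight_span_gen[of 1 1 0] by simp

lemma diff_c_in_weight_span: "diff c \<in> weight_span 2"
  using weight_span_gen[of 2 0 1] by simp

lemma diff_mult_in_weight_span:
  assumes "g \<in> carrier G" "h \<in> carrier G" "diff g \<in> weight_span n" "diff h \<in> weight_span n"
  shows "diff (g \<otimes>\<^bsub>G\<^esub> h) \<in> weight_span n"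
proof -
  have "diff g \<otimes> diff h \<in> weight_span n" using weight_span_mult[of "diff g" n "diff h" n] weight_span_antimono[of n "n + n"] assms by auto
  then show ?thesis using assms by (simp add: diff_mult weight_span_add)
qed

lemma diff_pow_in_weight_span:
  assumes "g \<in> carrier G" "diff g \<in> weight_span n"
  shows "diff (g [^]\<^bsub>G\<^esub> (m::nat)) \<in> weight_span n"
proof (induction m)
  case 0
  then show ?case using additive_subgroup.zero_closed[OF weight_span_subgroup] by simp
next
  case (Suc m)
  then show ?case using assms by (simp add: diff_mult_in_weight_span)
qed

text \<open>By Frobenius a^p - 1 = (a - 1)^p has weight p. Weight 3 is required because the
  correction to \<open>c\<close> must exceed the weight 2 of \<open>diff c\<close>; this is where
  \<open>p_ge_3\<close> enters.\<close>

lemma diff_a_pow_in_weight_span: "diff (a [^]\<^bsub>G\<^esub> (p * m)) \<in> weight_span 3"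
proof -
  have "diff (a [^]\<^bsub>G\<^esub> p) = diff a [^] p" using diff_pow_prime_power[of a 1] by simp
  also have "\<dots> \<in> weight_span p" using weight_span_gen[of p p 0] by simp
  finally have "diff (a [^]\<^bsub>G\<^esub> p) \<in> weight_span 3" using weight_span_antimono[OF p_ge_3] by auto
  then show ?thesis using diff_pow_in_weight_span[of "a [^]\<^bsub>G\<^esub> p" 3 m] by (simp add: G.nat_pow_pow)
qed

text \<open>Equality of the classes of two elements in degree \<open>n\<close> of the associated
  graded ring.\<close>

definition close :: "nat \<Rightarrow> 'r \<Rightarrow> 'r \<Rightarrow> bool" where
  "close n x y \<longleftrightarrow> x \<in> weight_span n \<and> y \<in> weight_span n \<and> y \<ominus> x \<in> weight_span (Suc n)"

lemma close_mult:
  assumes "close m x x'" "close n y y'"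
  shows "close (m + n) (x \<otimes> y) (x' \<otimes> y')"
proof -
  have c: "x \<in> carrier R" "x' \<in> carrier R" "y \<in> carrier R" "y' \<in> carrier R"
    using assms weight_span_carrier by (auto simp: close_def)
  \<comment> \<open>The usual telescoping x'y' - xy = x'(y' - y) + (x' - x)y; each summand gains one
    degree.\<close>
  have "x' \<otimes> (y' \<ominus> y) \<oplus> (x' \<ominus> x) \<otimes> y \<in> weight_span (Suc (m + n))"
    using assms weight_span_mult[of x' m "y' \<ominus> y" "Suc n"] weight_span_mult[of "x' \<ominus> x" "Suc m" y n]
    by (intro weight_span_add) (auto simp: close_def)
  also have "x' \<otimes> (y' \<ominus> y) \<oplus> (x' \<ominus> x) \<otimes> y = x' \<otimes> y' \<ominus> x \<otimes> y"
    using c by (simp add: minus_eq r_distr l_distr r_minus l_minus a_assoc r_neg1 r_neg2)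
  finally show ?thesis using assms by (auto simp: close_def intro: weight_span_mult)
qed

lemma close_one: "close 0 \<one> \<one>"
  using one_in_weight_span additive_subgroup.zero_closed[OF weight_span_subgroup] by (simp add: close_def minus_eq r_neg)

lemma close_pow:
  assumes "close n x y"
  shows "close (n * i) (x [^] i) (y [^] i)"
proof (induction i)
  case 0
  then show ?case using close_one by simp
next
  case (Suc i)
  then show ?case using close_mult[OF Suc assms] by (simp add: add.commute)
qed

lemma close_diff:
  assumes "g \<in> carrier G" "r \<in> carrier G" "diff g \<in> weight_span n" "diff r \<in> weight_span (Suc n)"
  shows "close n (diff g) (diff (g \<otimes>\<^bsub>G\<^esub> r))"
proof -
  have 1: "diff g \<otimes> diff r \<in> weight_span (Suc n)"
    using weight_span_mult[of "diff g" n "diff r" "Suc n"] weight_span_antimono[of "Suc n" "n + Suc n"] assms by auto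
  have "diff (g \<otimes>\<^bsub>G\<^esub> r) = diff g \<oplus> (diff g \<otimes> diff r \<oplus> diff r)"
    using assms by (simp add: diff_mult a_ac)
  then have "diff (g \<otimes>\<^bsub>G\<^esub> r) \<ominus> diff g = diff g \<otimes> diff r \<oplus> diff r"
    using assms by (simp add: add_minus_cancel)
  then have 2: "diff (g \<otimes>\<^bsub>G\<^esub> r) \<ominus> diff g \<in> weight_span (Suc n)" using 1 assms by (simp add: weight_span_add)
  have "diff (g \<otimes>\<^bsub>G\<^esub> r) \<in> weight_span n"
    using assms weight_span_antimono[of n "Suc n"] by (intro diff_mult_in_weight_span) auto
  then show ?thesis using assms 2 by (simp add: close_def)
qed

definition conj_b :: "'r \<Rightarrow> 'r" where
  "conj_b x = e (inv\<^bsub>G\<^esub> b) \<otimes> x \<otimes> e b"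

lemma e_inv_b: "e (inv\<^bsub>G\<^esub> b) \<otimes> e b = \<one>" "e b \<otimes> e (inv\<^bsub>G\<^esub> b) = \<one>"
  by (simp_all flip: e_mult)

lemma conj_b_closed [simp]: "x \<in> carrier R \<Longrightarrow> conj_b x \<in> carrier R"
  by (simp add: conj_b_def)

lemma conj_b_add: "x \<in> carrier R \<Longrightarrow> y \<in> carrier R \<Longrightarrow> conj_b (x \<oplus> y) = conj_b x \<oplus> conj_b y"
  by (simp add: conj_b_def l_distr r_distr)

lemma conj_b_mult:
  assumes "x \<in> carrier R" "y \<in> carrier R"
  shows "conj_b (x \<otimes> y) = conj_b x \<otimes> conj_b y"
proof -
  have "conj_b x \<otimes> conj_b y = e (inv\<^bsub>G\<^esub> b) \<otimes> x \<otimes> (e b \<otimes> e (inv\<^bsub>G\<^esub> b)) \<otimes> y \<otimes> e b"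
    using assms by (simp add: conj_b_def m_assoc del: e_inv_b)
  then show ?thesis using assms by (simp add: conj_b_def e_inv_b m_assoc)
qed

lemma conj_b_pow: "x \<in> carrier R \<Longrightarrow> conj_b (x [^] (n::nat)) = conj_b x [^] n"
  by (induction n) (auto simp: conj_b_mult, simp add: conj_b_def e_inv_b)

lemma conj_b_diff:
  assumes "g \<in> carrier G"
  shows "conj_b (diff g) = diff (inv\<^bsub>G\<^esub> b \<otimes>\<^bsub>G\<^esub> g \<otimes>\<^bsub>G\<^esub> b)"
  using assms by (simp add: conj_b_def diff_def e_mult minus_eq l_distr r_distr l_minus r_minus e_inv_b)

text \<open>Conjugation by \<open>b\<close> is multiplicative and acts trivially on the associated
  graded ring: it changes \<open>diff a\<close> by weight at least 2 and \<open>diff c\<close> by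
  weight at least 3, hence every monomial by higher weight.\<close>

lemma close_conj_b:
  assumes x: "x \<in> weight_span n"
  shows "conj_b x \<ominus> x \<in> weight_span (Suc n)"
proof (rule add_span_map[OF _ weight_span_subgroup, where f = "\<lambda>x. conj_b x \<ominus> x", OF _ _ _ _ x[unfolded weight_span_def]])
  fix x assume "x \<in> {diff a [^] i \<otimes> diff c [^] k | i k. n \<le> i + 2 * k}"
  then obtain i k where x: "x = diff a [^] i \<otimes> diff c [^] k" "n \<le> i + 2 * k" by blast
  have "diff (a [^]\<^bsub>G\<^esub> (p * u) \<otimes>\<^bsub>G\<^esub> c [^]\<^bsub>G\<^esub> v) \<in> weight_span 2"
    using diff_a_pow_in_weight_span[of u] weight_span_antimono[of 2 3] diff_pow_in_weight_span[of c 2 v] diff_c_in_weight_span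
    by (intro diff_mult_in_weight_span) auto
  then have "close 1 (diff a) (conj_b (diff a))"
    using diff_a_in_weight_span by (auto simp: conj_b_diff conj_a numeral_2_eq_2 intro!: close_diff)
  moreover have "close 2 (diff c) (conj_b (diff c))"
    using diff_c_in_weight_span diff_a_pow_in_weight_span by (auto simp: conj_b_diff conj_c numeral_3_eq_3 numeral_2_eq_2 intro!: close_diff)
  ultimately have "close (1 * i + 2 * k) x (conj_b x)"
    unfolding x(1) by (simp only: conj_b_mult conj_b_pow nat_pow_closed diff_closed gens) (intro close_mult close_pow)
  then show "conj_b x \<ominus> x \<in> weight_span (Suc n)"
    using x(2) weight_span_antimono[of "Suc n" "Suc (i + 2 * k)"] by (auto simp: close_def)
qed (auto simp: conj_b_add minus_eq minus_add a_ac)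

lemma conj_b_in_weight_span: "x \<in> weight_span n \<Longrightarrow> conj_b x \<in> weight_span n"
  using close_conj_b[of x n] weight_span_antimono[of n "Suc n"] weight_span_add[of "conj_b x \<ominus> x" n x] weight_span_carrier[of x n]
  by (auto simp: minus_eq a_assoc l_neg)

text \<open>Collection rule that keeps powers of \<open>diff b\<close> on the left, obtained from x
  b = b (b^(-1) x b). The second summand gains weight by \<open>close_conj_b\<close>.\<close>

lemma mult_diff_b:
  assumes "x \<in> carrier R"
  shows "x \<otimes> diff b = diff b \<otimes> conj_b x \<oplus> (conj_b x \<ominus> x)"
proof -
  have "e b \<otimes> conj_b x = (e b \<otimes> e (inv\<^bsub>G\<^esub> b)) \<otimes> x \<otimes> e b"
    using assms by (simp add: conj_b_def m_assoc)
  then have "(\<one> \<oplus> diff b) \<otimes> conj_b x = x \<otimes> (\<one> \<oplus> diff b)"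
    using assms by (simp add: e_inv_b flip: e_diff)
  then have "diff b \<otimes> conj_b x \<oplus> conj_b x \<ominus> x = x \<oplus> x \<otimes> diff b \<ominus> x"
    using assms by (simp add: l_distr r_distr a_ac)
  then show ?thesis using assms by (simp add: minus_eq a_ac r_neg1 r_neg2)
qed

definition group_weight_span :: "nat \<Rightarrow> 'r set" where
  "group_weight_span n = add_span {diff b [^] j \<otimes> x | j x. \<exists>m. x \<in> weight_span m \<and> n \<le> j + m}"

lemma group_weight_span_gens_carrier: "{diff b [^] j \<otimes> x | (j::nat) x. \<exists>m. x \<in> weight_span m \<and> n \<le> j + m} \<subseteq> carrier R"
  by (auto dest: weight_span_carrier)

lemma group_weight_span_subgroup: "additive_subgroup (group_weight_span n) R"
  unfolding group_weight_span_def by (intro add_span_subgroup group_weight_span_gens_carrier)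

lemma group_weight_span_carrier: "x \<in> group_weight_span n \<Longrightarrow> x \<in> carrier R"
  using additive_subgroup.a_subset[OF group_weight_span_subgroup] by blast

lemma group_weight_span_add: "x \<in> group_weight_span n \<Longrightarrow> y \<in> group_weight_span n \<Longrightarrow> x \<oplus> y \<in> group_weight_span n"
  using additive_subgroup.a_closed[OF group_weight_span_subgroup] .

lemma group_weight_span_gen: "x \<in> weight_span m \<Longrightarrow> n \<le> j + m \<Longrightarrow> diff b [^] (j::nat) \<otimes> x \<in> group_weight_span n"
  unfolding group_weight_span_def by (intro add_span_incl) auto

lemma group_weight_span_antimono: "m \<le> n \<Longrightarrow> group_weight_span n \<subseteq> group_weight_span m"
  unfolding group_weight_span_def by (intro add_span_mono) (blast intro: le_trans)

text \<open>For \<open>a\<close> and \<open>c\<close> the weight of the right factor grows. For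
  \<open>b\<close>, \<open>mult_diff_b\<close> gives two terms: one with a higher power of
  \<open>diff b\<close>, one with a right factor of higher weight.\<close>

lemma group_weight_span_mult_gen:
  assumes g: "g \<in> {a, b, c}" and x: "x \<in> group_weight_span n"
  shows "x \<otimes> diff g \<in> group_weight_span (Suc n)"
proof (rule add_span_map[OF group_weight_span_gens_carrier group_weight_span_subgroup, where f = "\<lambda>x. x \<otimes> diff g", OF _ _ _ x[unfolded group_weight_span_def]])
  have gc: "g \<in> carrier G" using g by auto
  fix x assume "x \<in> {diff b [^] j \<otimes> x | (j::nat) x. \<exists>m. x \<in> weight_span m \<and> n \<le> j + m}"
  then obtain j :: nat and y m where y: "x = diff b [^] j \<otimes> y" "y \<in> weight_span m" "n \<le> j + m" by blast
  have yc: "y \<in> carrier R" using y weight_span_carrier by blast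
  consider "diff g \<in> weight_span 1" | "g = b" using g diff_a_in_weight_span diff_c_in_weight_span weight_span_antimono[of 1 2] by auto
  then show "x \<otimes> diff g \<in> group_weight_span (Suc n)"
  proof cases
    case 1
    have "x \<otimes> diff g = diff b [^] j \<otimes> (y \<otimes> diff g)" using y yc gc by (simp add: m_assoc)
    then show ?thesis using weight_span_mult[OF y(2) 1] y(3) by (auto intro: group_weight_span_gen)
  next
    case 2
    have "x \<otimes> diff g = diff b [^] Suc j \<otimes> conj_b y \<oplus> diff b [^] j \<otimes> (conj_b y \<ominus> y)"
    proof -
      have "x \<otimes> diff g = diff b [^] j \<otimes> (y \<otimes> diff b)" using y yc 2 by (simp add: m_assoc)
      also have "\<dots> = diff b [^] j \<otimes> (diff b \<otimes> conj_b y) \<oplus> diff b [^] j \<otimes> (conj_b y \<ominus> y)"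
        using yc by (simp only: mult_diff_b) (simp add: r_distr)
      finally show ?thesis using yc by (simp add: m_assoc)
    qed
    then show ?thesis
      using group_weight_span_gen[OF conj_b_in_weight_span[OF y(2)], of "Suc n" "Suc j"] group_weight_span_gen[OF close_conj_b[OF y(2)], of "Suc n" j] y(3)
      by (simp add: group_weight_span_add)
  qed
qed (use g in \<open>auto simp: l_distr\<close>)

text \<open>By gh - 1 = (g - 1)(h - 1) + (g - 1) + (h - 1) the elements with this property are
  closed under products, and \<open>normal_form\<close> writes each element as a product of
  generators.\<close>

lemma group_weight_span_mult_diff:
  assumes g: "g \<in> carrier G"
  shows "\<forall>n. \<forall>x\<in>group_weight_span n. x \<otimes> diff g \<in> group_weight_span (Suc n)"
proof -
  let ?L = "{g \<in> carrier G. \<forall>n. \<forall>x\<in>group_weight_span n. x \<otimes> diff g \<in> group_weight_span (Suc n)}"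
  have mult: "g \<otimes>\<^bsub>G\<^esub> h \<in> ?L" if gh: "g \<in> ?L" "h \<in> ?L" for g h
  proof -
    have "x \<otimes> diff (g \<otimes>\<^bsub>G\<^esub> h) \<in> group_weight_span (Suc n)" if x: "x \<in> group_weight_span n" for x n
    proof -
      have 1: "x \<otimes> diff g \<in> group_weight_span (Suc n)" "x \<otimes> diff h \<in> group_weight_span (Suc n)" using gh x by auto
      then have "x \<otimes> diff g \<otimes> diff h \<in> group_weight_span (Suc n)" using gh group_weight_span_antimono[of "Suc n" "Suc (Suc n)"] by auto
      moreover have "x \<otimes> diff (g \<otimes>\<^bsub>G\<^esub> h) = x \<otimes> diff g \<otimes> diff h \<oplus> x \<otimes> diff g \<oplus> x \<otimes> diff h"
        using gh group_weight_span_carrier[OF x] by (simp add: diff_mult r_distr m_assoc)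
      ultimately show ?thesis using 1 by (simp add: group_weight_span_add)
    qed
    then show ?thesis using gh by auto
  qed
  have one: "\<one>\<^bsub>G\<^esub> \<in> ?L"
    using additive_subgroup.zero_closed[OF group_weight_span_subgroup] group_weight_span_carrier by auto
  have pow: "g [^]\<^bsub>G\<^esub> (n::nat) \<in> ?L" if "g \<in> {a, b, c}" for g n
  proof (induction n)
    case 0
    then show ?case using one by simp
  next
    case (Suc n)
    have "g \<in> ?L" using that group_weight_span_mult_gen by auto
    then show ?case using mult[OF Suc] by simp
  qed
  obtain k i j :: nat where "g = c [^]\<^bsub>G\<^esub> k \<otimes>\<^bsub>G\<^esub> a [^]\<^bsub>G\<^esub> i \<otimes>\<^bsub>G\<^esub> b [^]\<^bsub>G\<^esub> j"
    using normal_form[OF g] by blast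
  then have "g \<in> ?L" by (simp only:) (intro mult pow, simp_all)
  then show ?thesis by simp
qed

lemma group_weight_span_0: "group_weight_span 0 = carrier R"
proof -
  have "e g \<in> group_weight_span 0" if "g \<in> carrier G" for g
  proof -
    have 1: "\<one> \<in> group_weight_span 0" using group_weight_span_gen[OF one_in_weight_span, of 0 0] by simp
    then have "\<one> \<otimes> diff g \<in> group_weight_span 0" using group_weight_span_mult_diff[OF that] group_weight_span_antimono[of 0 1] by auto
    then show ?thesis using 1 that by (simp add: e_diff group_weight_span_add)
  qed
  then have "add_span (e ` carrier G) \<subseteq> group_weight_span 0" by (intro add_span_minimal group_weight_span_subgroup) auto
  then show ?thesis using spanning group_weight_span_carrier by auto
qed

lemma filtration_group_weight_span: "filtration group_weight_span"
  unfolding filtration_def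
proof (intro conjI allI ballI group_weight_span_0 group_weight_span_subgroup)
  fix n x g assume x: "x \<in> group_weight_span n" and g: "g \<in> carrier G"
  have "x \<otimes> (\<one> \<ominus> e g) = \<ominus> (x \<otimes> diff g)"
    using group_weight_span_carrier[OF x] g by (simp add: diff_def minus_eq r_distr r_minus minus_add a_ac)
  then show "x \<otimes> (\<one> \<ominus> e g) \<in> group_weight_span (Suc n)"
    using group_weight_span_mult_diff[OF g] x additive_subgroup.a_inv_closed[OF group_weight_span_subgroup] by auto
qed

text \<open>Above the maximal weight some exponent reaches the corresponding power of p, and that
  power of \<open>diff a\<close>, \<open>diff b\<close> or \<open>diff c\<close> is zero by
  Frobenius.\<close>

lemma group_weight_span_top: "group_weight_span (Suc ((p ^ \<alpha> - 1) + (p ^ \<beta> - 1) + 2 * (p ^ \<sigma> - 1))) = {\<zero>}"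
proof -
  have zero: "additive_subgroup {\<zero>} R"
    by (auto intro!: additive_subgroup.intro add.subgroupI simp flip: a_inv_def)
  have weight_span: "weight_span m = {\<zero>}" if m: "(p ^ \<alpha> - 1) + 2 * (p ^ \<sigma> - 1) < m" for m
  proof -
    have "diff a [^] i \<otimes> diff c [^] k = \<zero>" if "m \<le> i + 2 * k" for i k :: nat
    proof -
      have "p ^ \<alpha> \<le> i \<or> p ^ \<sigma> \<le> k" using that m by linarith
      then show ?thesis using diff_nilpotent[OF _ pow_a] diff_nilpotent[OF _ pow_c] by auto
    qed
    then have "weight_span m \<subseteq> {\<zero>}" unfolding weight_span_def by (intro add_span_minimal zero) auto
    then show ?thesis using additive_subgroup.zero_closed[OF weight_span_subgroup] by blast
  qed
  have "diff b [^] j \<otimes> x = \<zero>"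
    if "x \<in> weight_span m" "Suc ((p ^ \<alpha> - 1) + (p ^ \<beta> - 1) + 2 * (p ^ \<sigma> - 1)) \<le> j + m" for j :: nat and x m
  proof (cases "p ^ \<beta> \<le> j")
    case True
    then show ?thesis using diff_nilpotent[OF _ pow_b] weight_span_carrier[OF that(1)] by auto
  next
    case False
    then have "x = \<zero>" using that weight_span[of m] by auto
    then show ?thesis by simp
  qed
  then have "group_weight_span (Suc ((p ^ \<alpha> - 1) + (p ^ \<beta> - 1) + 2 * (p ^ \<sigma> - 1))) \<subseteq> {\<zero>}"
    unfolding group_weight_span_def by (intro add_span_minimal zero) auto
  then show ?thesis using additive_subgroup.zero_closed[OF group_weight_span_subgroup] by blast
qed

end

section \<open>The group algebra over the field with p elements\<close>

lemma modular_group_ring_group_algebra: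
  fixes G :: "('a, 'b) monoid_scheme" and p :: nat
  assumes p: "Factorial_Ring.prime p" and G: "group G" and fin: "finite (carrier G)"
  shows "modular_group_ring (group_algebra (residue_ring (int p)) G) G
    (\<lambda>g. \<lambda>x\<in>carrier G. if x = g then 1 else 0) p"
proof -
  let ?F = "residue_ring (int p)"
  let ?K = "group_algebra ?F G"
  define e where "e = (\<lambda>g. \<lambda>x\<in>carrier G. if x = g then 1 else (0::int))"
  interpret G: group G by fact
  have p1: "int p > 1" using prime_gt_1_nat[OF p] by simp
  interpret F: residues "int p" ?F by unfold_locales (use p1 in auto)
  have F: "carrier ?F = {0..int p - 1}" "\<zero>\<^bsub>?F\<^esub> = 0" "\<one>\<^bsub>?F\<^esub> = 1"
    "x \<oplus>\<^bsub>?F\<^esub> y = (x + y) mod int p" "x \<otimes>\<^bsub>?F\<^esub> y = (x * y) mod int p" for x y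
    by (simp_all add: residue_ring_def)
  interpret K: ring ?K by (rule group_algebra_ring[OF F.ring_axioms G fin])
  have K: "carrier ?K = carrier G \<rightarrow>\<^sub>E {0..int p - 1}" "\<zero>\<^bsub>?K\<^esub> = (\<lambda>x\<in>carrier G. 0)"
    "f \<oplus>\<^bsub>?K\<^esub> h = (\<lambda>x\<in>carrier G. (f x + h x) mod int p)" for f h
    by (simp_all add: group_algebra_def F)
  have add_pow: "add_pow ?K n f = (\<lambda>x\<in>carrier G. (int n * f x) mod int p)"
    if "f \<in> carrier ?K" for f and n :: nat
  proof (induction n)
    case 0
    show ?case by (simp add: K)
  next
    case (Suc n)
    then show ?case by (auto simp: K fun_eq_iff algebra_simps mod_simps)
  qed
  have e_closed: "e g \<in> carrier ?K" if "g \<in> carrier G" for g using p1 by (auto simp: K e_def)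
  have e_mult: "e (g \<otimes>\<^bsub>G\<^esub> h) = e g \<otimes>\<^bsub>?K\<^esub> e h" if g: "g \<in> carrier G" and h: "h \<in> carrier G" for g h
  proof -
    have "finsum ?F (\<lambda>y. e g y \<otimes>\<^bsub>?F\<^esub> e h (inv\<^bsub>G\<^esub> y \<otimes>\<^bsub>G\<^esub> x)) (carrier G)
        = (if x = g \<otimes>\<^bsub>G\<^esub> h then 1 else 0)" if x: "x \<in> carrier G" for x
    proof -
      have "finsum ?F (\<lambda>y. e g y \<otimes>\<^bsub>?F\<^esub> e h (inv\<^bsub>G\<^esub> y \<otimes>\<^bsub>G\<^esub> x)) (carrier G)
          = finsum ?F (\<lambda>y. if g = y then (if inv\<^bsub>G\<^esub> y \<otimes>\<^bsub>G\<^esub> x = h then \<one>\<^bsub>?F\<^esub> else \<zero>\<^bsub>?F\<^esub>) else \<zero>\<^bsub>?F\<^esub>) (carrier G)"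
        using x p1 by (intro F.finsum_cong') (auto simp: F e_def)
      also have "\<dots> = (if inv\<^bsub>G\<^esub> g \<otimes>\<^bsub>G\<^esub> x = h then \<one>\<^bsub>?F\<^esub> else \<zero>\<^bsub>?F\<^esub>)"
        using g fin by (intro F.add.finprod_singleton) auto
      also have "inv\<^bsub>G\<^esub> g \<otimes>\<^bsub>G\<^esub> x = h \<longleftrightarrow> x = g \<otimes>\<^bsub>G\<^esub> h"
        using g h x by (metis G.inv_solve_left)
      finally show ?thesis by (simp add: F)
    qed
    then show ?thesis using g h by (auto simp: group_algebra_def fun_eq_iff e_def)
  qed
  have e_one: "e \<one>\<^bsub>G\<^esub> = \<one>\<^bsub>?K\<^esub>"
    by (simp add: group_algebra_def F e_def cong: if_cong)
  have sub: "additive_subgroup (K.add_span (e ` H)) ?K" if "H \<subseteq> carrier G" for H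
    using that e_closed by (intro K.add_span_subgroup) auto
  \<comment> \<open>Induction on a finite set containing the support: the coefficient at
    \<open>s\<close> is removed by splitting off \<open>nat (f s)\<close> copies of
    \<open>e s\<close>.\<close>
  have span: "f \<in> K.add_span (e ` carrier G)"
    if "finite S" "f \<in> carrier ?K" "\<And>x. x \<in> carrier G - S \<Longrightarrow> f x = 0" for S f
    using that
  proof (induction S arbitrary: f rule: finite_induct)
    case empty
    then have "f = \<zero>\<^bsub>?K\<^esub>" by (auto simp: K fun_eq_iff PiE_def extensional_def)
    then show ?case using additive_subgroup.zero_closed[OF sub[of "carrier G"]] by simp
  next
    case (insert s S)
    show ?case
    proof (cases "s \<in> carrier G")
      case False
      then show ?thesis using insert by auto
    next
      case True
      define h where "h = (\<lambda>x\<in>carrier G. if x = s then 0 else f x)"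
      have h: "h \<in> carrier ?K" using insert.prems(1) p1 by (auto simp: h_def K)
      then have "h \<in> K.add_span (e ` carrier G)"
        using insert.prems(2) by (intro insert.IH h) (auto simp: h_def)
      moreover have "add_pow ?K n (e s) \<in> K.add_span (e ` carrier G)" for n :: nat
      proof (induction n)
        case 0
        then show ?case using additive_subgroup.zero_closed[OF sub[of "carrier G"]] by simp
      next
        case (Suc n)
        then show ?case
          using additive_subgroup.a_closed[OF sub[of "carrier G"]] True
          by (auto intro: K.add_span_incl)
      qed
      moreover have "f = h \<oplus>\<^bsub>?K\<^esub> add_pow ?K (nat (f s)) (e s)"
      proof
        fix x
        have "f x \<in> {0..int p - 1}" if "x \<in> carrier G" for x using insert.prems(1) that by (auto simp: K)
        moreover have "f x = undefined" if "x \<notin> carrier G"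
          using insert.prems(1) that by (auto simp: K PiE_def extensional_def)
        ultimately show "f x = (h \<oplus>\<^bsub>?K\<^esub> add_pow ?K (nat (f s)) (e s)) x"
          unfolding add_pow[OF e_closed[OF True]] using True by (auto simp: K h_def e_def)
      qed
      ultimately show ?thesis
        using additive_subgroup.a_closed[OF sub[of "carrier G"]] by (metis order_refl)
    qed
  qed
  \<comment> \<open>The functions vanishing at the identity form an additive subgroup that contains
    every other basis element but not the unit.\<close>
  have indep: "K.add_span (e ` (carrier G - {\<one>\<^bsub>G\<^esub>})) \<subseteq> {f \<in> carrier ?K. f \<one>\<^bsub>G\<^esub> = 0}"
  proof (rule K.add_span_minimal)
    show "e ` (carrier G - {\<one>\<^bsub>G\<^esub>}) \<subseteq> {f \<in> carrier ?K. f \<one>\<^bsub>G\<^esub> = 0}"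
      using e_closed by (auto simp: e_def)
    \<comment> \<open>Negation has no coefficient formula at hand; its value is recovered from f +
      (-f) = 0 and the range of residues.\<close>
    have "(\<ominus>\<^bsub>?K\<^esub> f) \<one>\<^bsub>G\<^esub> = 0" if "f \<in> carrier ?K" "f \<one>\<^bsub>G\<^esub> = 0" for f
    proof -
      have "(f \<oplus>\<^bsub>?K\<^esub> (\<ominus>\<^bsub>?K\<^esub> f)) \<one>\<^bsub>G\<^esub> = 0" using that by (simp only: K.r_neg) (simp add: K)
      then have "(\<ominus>\<^bsub>?K\<^esub> f) \<one>\<^bsub>G\<^esub> mod int p = 0" using that by (simp add: K)
      moreover have "(\<ominus>\<^bsub>?K\<^esub> f) \<one>\<^bsub>G\<^esub> \<in> {0..int p - 1}"
        using K.a_inv_closed[OF that(1)] unfolding K by auto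
      ultimately show ?thesis by simp
    qed
    moreover have "(f \<oplus>\<^bsub>?K\<^esub> h) \<one>\<^bsub>G\<^esub> = 0" if "f \<one>\<^bsub>G\<^esub> = 0" "h \<one>\<^bsub>G\<^esub> = 0" for f h
      using that by (simp add: K)
    moreover have "\<zero>\<^bsub>?K\<^esub> \<one>\<^bsub>G\<^esub> = 0" by (simp add: K)
    ultimately show "additive_subgroup {f \<in> carrier ?K. f \<one>\<^bsub>G\<^esub> = 0} ?K"
      by (intro additive_subgroup.intro K.add.subgroupI) (auto simp flip: a_inv_def)
  qed
  show ?thesis
    unfolding e_def[symmetric]
  proof (unfold_locales, goal_cases)
    case 1 show ?case by (rule p)
  next
    case (2 f)
    then show ?case by (simp add: add_pow) (simp add: K)
  next
    case (3 g)
    then show ?case by (rule e_closed)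
  next
    case (4 g h)
    then show ?case by (rule e_mult)
  next
    case 5 show ?case by (rule e_one)
  next
    case 6
    have "K.add_span (e ` carrier G) \<subseteq> carrier ?K" using e_closed by (intro K.add_span_carrier) auto
    then show ?case using span[OF fin] by blast
  next
    case 7
    have "\<one>\<^bsub>?K\<^esub> \<one>\<^bsub>G\<^esub> = 1" by (simp add: group_algebra_def F)
    then show ?case using indep by auto
  qed
qed

subsection \<open>Product-one free sequences\<close>

text \<open>Take \<open>d\<close> to be a non-square: squaring residues is not injective, as 1 and
  -1 have the same square, hence not surjective. If p did not divide x, then y/x would be a square
  root of \<open>d\<close>.\<close>

lemma exists_anisotropic:
  fixes p :: nat
  assumes p: "Factorial_Ring.prime p" and odd: "odd p"
  shows "\<exists>d::int. 0 \<le> d \<and> d < int p \<and> (\<forall>x y. [y\<^sup>2 = d * x\<^sup>2] (mod int p) \<longrightarrow> int p dvd x \<and> int p dvd y)"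
proof -
  have p3: "int p \<ge> 3" using p odd prime_ge_2_nat[of p] by (cases "p = 2") auto
  let ?S = "{0..<int p}"
  have "\<not> ?S \<subseteq> (\<lambda>x. x\<^sup>2 mod int p) ` ?S"
  proof
    assume sub: "?S \<subseteq> (\<lambda>x. x\<^sup>2 mod int p) ` ?S"
    then have "inj_on (\<lambda>x. x\<^sup>2 mod int p) ?S"
      by (intro eq_card_imp_inj_on antisym card_image_le card_mono) auto
    moreover have "(int p - 1)\<^sup>2 mod int p = 1\<^sup>2 mod int p"
      by (auto simp: mod_eq_dvd_iff power2_eq_square algebra_simps)
    ultimately have "int p - 1 = 1" using p3 by (auto dest!: inj_onD[where x = "int p - 1" and y = 1])
    then show False using p3 by simp
  qed
  then obtain d where d: "d \<in> ?S" "d \<notin> (\<lambda>x. x\<^sup>2 mod int p) ` ?S" by blast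
  have "int p dvd x" if xy: "[y\<^sup>2 = d * x\<^sup>2] (mod int p)" for x y
  proof (rule ccontr)
    assume "\<not> int p dvd x"
    then have "coprime x (int p)" using p prime_imp_coprime[of "int p" x] by (simp add: coprime_commute)
    then obtain z :: int where z: "[x * z = 1] (mod int p)" using cong_solve_coprime_int by blast
    have "[(y * z)\<^sup>2 = y\<^sup>2 * z\<^sup>2] (mod int p)" by (simp add: power_mult_distrib)
    also have "[y\<^sup>2 * z\<^sup>2 = (d * x\<^sup>2) * z\<^sup>2] (mod int p)" using xy by (rule cong_scalar_right)
    also have "(d * x\<^sup>2) * z\<^sup>2 = d * (x * z)\<^sup>2" by (simp add: power_mult_distrib)
    also have "[d * (x * z)\<^sup>2 = d * 1\<^sup>2] (mod int p)" using z by (intro cong_scalar_left cong_pow)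
    finally have "((y * z) mod int p)\<^sup>2 mod int p = d"
      using d(1) by (simp add: cong_def power_mod)
    then have "d \<in> (\<lambda>x. x\<^sup>2 mod int p) ` ?S"
      using p3 by (intro image_eqI[of _ _ "(y * z) mod int p"]) auto
    then show False using d(2) by simp
  qed
  moreover have "int p dvd y" if "[y\<^sup>2 = d * x\<^sup>2] (mod int p)" "int p dvd x" for x y
  proof -
    have "int p dvd d * x\<^sup>2" using that(2) by (simp add: power2_eq_square)
    then have "int p dvd y\<^sup>2" using that(1) by (simp add: cong_dvd_iff)
    then show ?thesis using p by (simp add: prime_dvd_power_iff)
  qed
  ultimately show ?thesis using d(1) by (intro exI[of _ d]) auto
qed

context group
begin

lemma foldr_append_mult:
  assumes "set xs \<subseteq> carrier G" "set ys \<subseteq> carrier G"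
  shows "foldr (\<otimes>) (xs @ ys) \<one> = foldr (\<otimes>) xs \<one> \<otimes> foldr (\<otimes>) ys \<one>"
proof -
  have cl: "foldr (\<otimes>) zs \<one> \<in> carrier G" if "set zs \<subseteq> carrier G" for zs
    using that by (induction zs) auto
  show ?thesis using assms by (induction xs) (auto simp: m_assoc cl)
qed

lemma foldr_replicate_mult: "x \<in> carrier G \<Longrightarrow> foldr (\<otimes>) (replicate n x) \<one> = x [^] n"
proof (induction n)
  case (Suc n)
  then show ?case using nat_pow_Suc2[of x n] by simp
qed simp

lemma pow_mod_ord:
  fixes m n :: nat
  assumes "x \<in> carrier G" "[m = n] (mod ord x)"
  shows "x [^] m = x [^] n"
proof -
  have "x [^] k = x [^] (k mod ord x)" for k :: nat
  proof -
    have "x [^] k = x [^] (ord x * (k div ord x) + k mod ord x)" by simp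
    also have "\<dots> = (x [^] ord x) [^] (k div ord x) \<otimes> x [^] (k mod ord x)"
      using assms(1) by (simp only: nat_pow_mult nat_pow_pow)
    also have "\<dots> = x [^] (k mod ord x)" using assms(1) by simp
    finally show ?thesis .
  qed
  then show ?thesis using assms(2) unfolding cong_def by metis
qed

end

text \<open>Common setting of the three families; in the second one \<open>c\<close> is the identity
  and \<sigma> = 0. No power of \<open>c\<close> occurs in \<open>comm_cb\<close>: in the third
  family its exponent is a multiple of p while \<open>c\<close> has order p.\<close>

locale split_extension = group G for G (structure) +
  fixes a b c :: 'a and N and p \<alpha> \<beta> \<sigma> u v w :: nat
  assumes p_prime: "Factorial_Ring.prime p" and p_odd: "odd p"
    and fin: "finite (carrier G)"
    and abc [simp]: "a \<in> carrier G" "b \<in> carrier G" "c \<in> carrier G"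
    and direct: "internal_direct_product G N (generate G {c}) (generate G {a})"
    and semidirect: "internal_semidirect_product G N (generate G {b})"
    and ord_a: "ord a = p ^ \<alpha>" and ord_b: "ord b = p ^ \<beta>" and ord_c: "ord c = p ^ \<sigma>"
    and comm_ab: "commutator G a b = a [^] (p * u) \<otimes> c [^] v"
    and comm_cb: "commutator G c b = a [^] (p * w)"
begin

lemma generate_pow_iff: "x \<in> carrier G \<Longrightarrow> g \<in> generate G {x} \<longleftrightarrow> (\<exists>n::nat. g = x [^] n)"
  using generate_pow_on_finite_carrier[OF fin] by auto

lemma comm_ac: "a \<otimes> c = c \<otimes> a"
proof -
  have "c \<otimes> a = a \<otimes> c"
    using direct by (auto simp: internal_direct_product_def intro: generate.incl)
  then show ?thesis by simp
qed

lemma pow_comm: "c [^] (k::nat) \<otimes> a [^] (i::nat) = a [^] i \<otimes> c [^] k"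
proof -
  have "a [^] i \<otimes> c = c \<otimes> a [^] i" by (rule group_commutes_pow[OF comm_ac]) simp_all
  then show ?thesis by (intro group_commutes_pow) simp_all
qed

lemma conj_eq_commutator:
  assumes "x \<in> carrier G" "y \<in> carrier G"
  shows "inv y \<otimes> x \<otimes> y = x \<otimes> commutator G x y"
  using assms by (simp add: commutator_def m_assoc inv_solve_left' flip: m_assoc[of x "inv x"])

lemma conj_a: "inv b \<otimes> a \<otimes> b = a \<otimes> (a [^] (p * u) \<otimes> c [^] v)"
  by (simp add: conj_eq_commutator comm_ab)

lemma conj_c: "inv b \<otimes> c \<otimes> b = c \<otimes> a [^] (p * w)"
  by (simp add: conj_eq_commutator comm_cb)

lemma factorization:
  assumes "g \<in> carrier G"
  shows "\<exists>(k::nat) (i::nat) (j::nat). g = c [^] k \<otimes> a [^] i \<otimes> b [^] j"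
proof -
  have "carrier G = N <#> generate G {b}" "N = generate G {c} <#> generate G {a}"
    using direct semidirect by (auto simp: internal_direct_product_def internal_semidirect_product_def)
  then obtain x y z where xyz: "x \<in> generate G {c}" "y \<in> generate G {a}" "z \<in> generate G {b}"
    "g = x \<otimes> y \<otimes> z"
    using assms unfolding set_mult_def by blast
  moreover obtain k i j :: "nat" where "x = c [^] k" "y = a [^] i" "z = b [^] j"
    using xyz(1-3) by (auto simp: generate_pow_iff)
  ultimately show ?thesis by blast
qed

text \<open>Uniqueness of the normal form at the identity: the trivial intersections of N with the
  powers of \<open>b\<close>, and of the powers of \<open>c\<close> with those of \<open>a\<close>,
  make each factor trivial.\<close>

lemma product_eq_one_imp_dvd:
  fixes j i k :: nat
  assumes eq: "b [^] j \<otimes> (a [^] i \<otimes> c [^] k) = \<one>"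
  shows "p ^ \<beta> dvd j" "p ^ \<alpha> dvd i" "p ^ \<sigma> dvd k"
proof -
  have N: "N = generate G {c} <#> generate G {a}" and Nb: "N \<inter> generate G {b} = {\<one>}"
    and ca: "generate G {c} \<inter> generate G {a} = {\<one>}"
    using direct semidirect unfolding internal_direct_product_def internal_semidirect_product_def by blast+
  have pow_gen: "x [^] n \<in> generate G {x}" "inv (x [^] n) \<in> generate G {x}"
    if "x \<in> carrier G" for x and n :: nat
  proof -
    show "x [^] n \<in> generate G {x}" using that generate_pow_iff by blast
    then show "inv (x [^] n) \<in> generate G {x}" using that by (intro generate_m_inv_closed) simp_all
  qed
  have inv_of: "y = inv x" if "x \<otimes> y = \<one>" "x \<in> carrier G" "y \<in> carrier G" for x y
    using inv_equality[OF inv_comm[OF that] that(2,3)] by (rule sym)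
  have "c [^] k \<otimes> a [^] i \<in> N" unfolding N set_mult_def using pow_gen(1)[OF abc(3), of k] pow_gen(1)[OF abc(1), of i] by blast
  then have "a [^] i \<otimes> c [^] k \<in> N" by (simp only: pow_comm)
  moreover have "a [^] i \<otimes> c [^] k = inv (b [^] j)" using eq by (intro inv_of) simp_all
  moreover have "inv (b [^] j) \<in> generate G {b}" by (rule pow_gen) simp
  ultimately have ac: "a [^] i \<otimes> c [^] k = \<one>" using Nb by (metis IntI singletonD)
  then have "c [^] k = inv (a [^] i)" by (intro inv_of) simp_all
  moreover have "c [^] k \<in> generate G {c}" "inv (a [^] i) \<in> generate G {a}" by (rule pow_gen; simp)+
  ultimately have ck: "c [^] k = \<one>" using ca by (metis IntI singletonD)
  then have ai: "a [^] i = \<one>" using ac by simp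
  then have "b [^] j = \<one>" using eq ck by simp
  then show "p ^ \<beta> dvd j" "p ^ \<alpha> dvd i" "p ^ \<sigma> dvd k"
    using ai ck ord_a ord_b ord_c pow_eq_id[of a i] pow_eq_id[of b j] pow_eq_id[of c k] by simp_all
qed

lemma davenport_eq_loewy_of_free:
  assumes gs: "length gs = (p ^ \<alpha> - 1) + (p ^ \<beta> - 1) + 2 * (p ^ \<sigma> - 1)" "set gs \<subseteq> carrier G"
    and free: "\<And>ys. subseq ys gs \<Longrightarrow> foldr (\<otimes>) ys \<one> = \<one> \<Longrightarrow> ys = []"
  shows "davenport_constant G = loewy_length (group_algebra (residue_ring (int p)) G)"
proof -
  interpret M: modular_group_ring "group_algebra (residue_ring (int p)) G" G
    "\<lambda>g. \<lambda>x\<in>carrier G. if x = g then 1 else 0" p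
    by (rule modular_group_ring_group_algebra[OF p_prime group_axioms fin])
  have p3: "p \<ge> 3" using p_prime p_odd prime_ge_2_nat[of p] by (cases "p = 2") auto
  interpret T: three_generated "group_algebra (residue_ring (int p)) G" G
    "\<lambda>g. \<lambda>x\<in>carrier G. if x = g then 1 else 0" p a b c \<alpha> \<beta> \<sigma> u v w
    by unfold_locales
      (use p3 conj_a conj_c comm_ac factorization in \<open>simp_all flip: ord_a ord_b ord_c\<close>)
  show ?thesis by (rule M.davenport_eq_loewy[OF T.filtration_group_weight_span T.group_weight_span_top gs free])
qed

lemma davenport_eq_loewy_trivial:
  assumes c: "\<sigma> = 0"
  shows "davenport_constant G = loewy_length (group_algebra (residue_ring (int p)) G)"
proof (rule davenport_eq_loewy_of_free)
  let ?gs = "replicate (p ^ \<beta> - 1) b @ replicate (p ^ \<alpha> - 1) a"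
  show "length ?gs = (p ^ \<alpha> - 1) + (p ^ \<beta> - 1) + 2 * (p ^ \<sigma> - 1)" using c by simp
  show "set ?gs \<subseteq> carrier G" by auto
  fix ys assume ys: "subseq ys ?gs" and one: "foldr (\<otimes>) ys \<one> = \<one>"
  obtain j i where ji: "j \<le> p ^ \<beta> - 1" "i \<le> p ^ \<alpha> - 1" "ys = replicate j b @ replicate i a"
    using ys by (auto simp: subseq_append_iff dest!: subseq_replicate)
  have p0: "p ^ n > 0" for n using p_prime prime_gt_0_nat by simp
  have "set (replicate j b) \<subseteq> carrier G" "set (replicate i a) \<subseteq> carrier G" by auto
  \<comment> \<open>The factor c^0 is inserted to match
    \<open>product_eq_one_imp_dvd\<close>.\<close>
  then have "b [^] j \<otimes> (a [^] i \<otimes> c [^] (0::nat)) = \<one>"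
    using one unfolding ji(3) by (simp add: foldr_append_mult foldr_replicate_mult del: foldr_replicate foldr_append)
  then have "p ^ \<beta> dvd j" "p ^ \<alpha> dvd i" by (rule product_eq_one_imp_dvd)+
  then have "j = 0" "i = 0" using ji(1,2) p0[of \<alpha>] p0[of \<beta>] by (auto dest: dvd_imp_le)
  then show "ys = []" using ji(3) by simp
qed

section \<open>Collection of exponents when \<open>c\<close> has order p\<close>

context
  assumes v: "v = 1" and sigma: "\<sigma> = 1"
begin

text \<open>Exponents of \<open>a\<close> are tracked modulo \<open>p\<close> only: conjugation by \<open>b\<close> may change them by
  multiples of \<open>p\<close>, which do not influence the exponent of \<open>c\<close>.\<close>

definition nf :: "nat \<Rightarrow> nat \<Rightarrow> nat \<Rightarrow> 'a \<Rightarrow> bool" where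
  "nf t s h g \<longleftrightarrow> (\<exists>x. [x = s] (mod p) \<and> g = b [^] t \<otimes> (a [^] x \<otimes> c [^] h))"

lemma pow_c_cong: "[h = h'] (mod p) \<Longrightarrow> c [^] h = c [^] h'" for h h' :: nat
  by (rule pow_mod_ord) (simp_all add: ord_c sigma)

lemma ac_mult:
  "(a [^] (x::nat) \<otimes> c [^] (h::nat)) \<otimes> (a [^] (x'::nat) \<otimes> c [^] (h'::nat)) = a [^] (x + x') \<otimes> c [^] (h + h')"
proof -
  have "(a [^] x \<otimes> c [^] h) \<otimes> (a [^] x' \<otimes> c [^] h') = a [^] x \<otimes> (c [^] h \<otimes> a [^] x') \<otimes> c [^] h'"
    by (simp add: m_assoc)
  also have "\<dots> = (a [^] x \<otimes> a [^] x') \<otimes> (c [^] h \<otimes> c [^] h')"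
    by (simp only: pow_comm) (simp add: m_assoc)
  finally show ?thesis by (simp add: nat_pow_mult)
qed

lemma ac_pow: "(a [^] (x::nat) \<otimes> c [^] (h::nat)) [^] (n::nat) = a [^] (x * n) \<otimes> c [^] (h * n)"
  by (induction n) (simp_all add: ac_mult add.commute)

text \<open>Conjugation by \<open>b\<close> is a homomorphism with a -> a^(1+pu) c and c -> a^(pw)
  c, which determines it on all products of powers.\<close>

lemma ac_mult_b:
  "(a [^] (x::nat) \<otimes> c [^] (h::nat)) \<otimes> b = b \<otimes> (a [^] (x + p * (u * x + w * h)) \<otimes> c [^] (h + x))"
proof -
  define k where "k g = inv b \<otimes> g \<otimes> b" for g
  have k_mult: "k (g \<otimes> g') = k g \<otimes> k g'" if "g \<in> carrier G" "g' \<in> carrier G" for g g'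
  proof -
    have "b \<otimes> (inv b \<otimes> (g' \<otimes> b)) = g' \<otimes> b" using that by (simp flip: m_assoc)
    then show ?thesis using that by (simp add: k_def m_assoc)
  qed
  have k_pow: "k (g [^] (n::nat)) = k g [^] n" if "g \<in> carrier G" for g n
    using that by (induction n) (simp_all add: k_mult, simp add: k_def)
  have ka: "k a = a [^] (1 + p * u) \<otimes> c [^] (1::nat)"
  proof -
    have "a [^] (1 + p * u) = a \<otimes> a [^] (p * u)" using nat_pow_Suc2[of a "p * u"] by simp
    then show ?thesis by (simp add: k_def conj_a v m_assoc)
  qed
  have kc: "k c = a [^] (p * w) \<otimes> c [^] (1::nat)"
    using pow_comm[of 1 "p * w"] by (simp add: k_def conj_c)
  have "k (a [^] x \<otimes> c [^] h) = a [^] ((1 + p * u) * x + p * w * h) \<otimes> c [^] (x + h)"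
    by (simp add: k_mult k_pow ka kc ac_pow ac_mult del: One_nat_def nat_pow_eone)
  also have "(1 + p * u) * x + p * w * h = x + p * (u * x + w * h)" by (simp add: algebra_simps)
  also have "x + h = h + x" by simp
  finally have "b \<otimes> k (a [^] x \<otimes> c [^] h) = b \<otimes> (a [^] (x + p * (u * x + w * h)) \<otimes> c [^] (h + x))"
    by simp
  then show ?thesis by (simp add: k_def m_assoc flip: m_assoc[of b "inv b"])
qed

text \<open>Each passage of \<open>b\<close> adds the current exponent of \<open>a\<close> to that
  of \<open>c\<close>. That exponent stays \<open>x\<close> modulo p, and only its residue matters
  for \<open>c\<close>.\<close>

lemma ac_mult_b_pow:
  "\<exists>x'. [x' = x] (mod p) \<and>
     (a [^] (x::nat) \<otimes> c [^] (h::nat)) \<otimes> b [^] (t::nat) = b [^] t \<otimes> (a [^] x' \<otimes> c [^] (h + x * t))"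
proof (induction t)
  case 0
  then show ?case by (intro exI[of _ x]) simp
next
  case (Suc t)
  then obtain x' where x': "[x' = x] (mod p)"
    "(a [^] x \<otimes> c [^] h) \<otimes> b [^] t = b [^] t \<otimes> (a [^] x' \<otimes> c [^] (h + x * t))" by blast
  let ?y = "x' + p * (u * x' + w * (h + x * t))"
  have "(a [^] x \<otimes> c [^] h) \<otimes> b [^] Suc t = ((a [^] x \<otimes> c [^] h) \<otimes> b [^] t) \<otimes> b"
    by (simp add: m_assoc)
  also have "\<dots> = b [^] t \<otimes> ((a [^] x' \<otimes> c [^] (h + x * t)) \<otimes> b)"
    unfolding x'(2) by (simp add: m_assoc)
  also have "\<dots> = b [^] Suc t \<otimes> (a [^] ?y \<otimes> c [^] (h + x * t + x'))"
    unfolding ac_mult_b by (simp add: m_assoc)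
  also have "c [^] (h + x * t + x') = c [^] (h + x * Suc t)"
  proof (rule pow_c_cong)
    have "[h + x * t + x' = h + x * t + x] (mod p)" using x'(1) by (intro cong_add) auto
    then show "[h + x * t + x' = h + x * Suc t] (mod p)" by (simp add: algebra_simps)
  qed
  finally have "(a [^] x \<otimes> c [^] h) \<otimes> b [^] Suc t = b [^] Suc t \<otimes> (a [^] ?y \<otimes> c [^] (h + x * Suc t))" .
  moreover have "[?y = x] (mod p)" using x'(1) by (simp add: cong_def)
  ultimately show ?case by blast
qed

lemma nf_closed: "nf t s h g \<Longrightarrow> g \<in> carrier G"
  by (auto simp: nf_def)

text \<open>The multiplication law of the Heisenberg group modulo p: the term \<open>s * t'\<close>
  arises from moving b^t' to the left past a^s.\<close>

lemma nf_mult: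
  assumes "nf t s h g" "nf t' s' h' g'"
  shows "nf (t + t') (s + s') (h + h' + s * t') (g \<otimes> g')"
proof -
  obtain x where x: "[x = s] (mod p)" "g = b [^] t \<otimes> (a [^] x \<otimes> c [^] h)"
    using assms by (auto simp: nf_def)
  obtain x' where x': "[x' = s'] (mod p)" "g' = b [^] t' \<otimes> (a [^] x' \<otimes> c [^] h')"
    using assms by (auto simp: nf_def)
  obtain y where y: "[y = x] (mod p)"
    "(a [^] x \<otimes> c [^] h) \<otimes> b [^] t' = b [^] t' \<otimes> (a [^] y \<otimes> c [^] (h + x * t'))"
    using ac_mult_b_pow by blast
  have "g \<otimes> g' = b [^] t \<otimes> ((a [^] x \<otimes> c [^] h) \<otimes> b [^] t') \<otimes> (a [^] x' \<otimes> c [^] h')"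
    by (simp add: x x' m_assoc)
  also have "\<dots> = b [^] (t + t') \<otimes> ((a [^] y \<otimes> c [^] (h + x * t')) \<otimes> (a [^] x' \<otimes> c [^] h'))"
    unfolding y(2) by (simp add: m_assoc flip: nat_pow_mult)
  also have "\<dots> = b [^] (t + t') \<otimes> (a [^] (y + x') \<otimes> c [^] (h + x * t' + h'))"
    by (simp only: ac_mult)
  also have "c [^] (h + x * t' + h') = c [^] (h + h' + s * t')"
  proof (rule pow_c_cong)
    have "[h + h' + x * t' = h + h' + s * t'] (mod p)" using x(1) by (intro cong_add cong_scalar_right) auto
    then show "[h + x * t' + h' = h + h' + s * t'] (mod p)" by (simp add: algebra_simps)
  qed
  finally show ?thesis
    unfolding nf_def using cong_add[OF cong_trans[OF y(1) x(1)] x'(1)] by blast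
qed

text \<open>In general twice the exponent of \<open>c\<close> in the n-th power is 2hn + ts n(n-1).
  The choice of \<open>h\<close> cancels the linear part and leaves a pure square.\<close>

lemma nf_pow:
  assumes g: "nf t s h g" and h: "[2 * h = t * s] (mod p)"
  shows "\<exists>e. nf (t * n) (s * n) e (g [^] n) \<and> [2 * e = t * s * n\<^sup>2] (mod p)"
proof (induction n)
  case 0
  have "nf 0 0 0 \<one>" unfolding nf_def by (intro exI[of _ 0]) simp
  then show ?case by (intro exI[of _ 0]) simp
next
  case (Suc n)
  then obtain e where e: "nf (t * n) (s * n) e (g [^] n)" "[2 * e = t * s * n\<^sup>2] (mod p)" by blast
  have "nf (t * Suc n) (s * Suc n) (e + h + s * n * t) (g [^] Suc n)"
    using nf_mult[OF e(1) g] by (simp add: algebra_simps)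
  moreover have "[2 * e + 2 * h + 2 * (s * n * t) = t * s * n\<^sup>2 + t * s + 2 * (s * n * t)] (mod p)"
    using e(2) h by (intro cong_add) auto
  moreover have "2 * e + 2 * h + 2 * (s * n * t) = 2 * (e + h + s * n * t)"
    "t * s * n\<^sup>2 + t * s + 2 * (s * n * t) = t * s * (Suc n)\<^sup>2"
    by (simp_all add: algebra_simps power2_eq_square)
  ultimately show ?case by metis
qed

text \<open>Twice the exponent of \<open>c\<close> in a product of \<open>x\<close> copies of \<open>g1\<close> and \<open>y\<close> copies of \<open>g2\<close>
  is \<open>(x + y)\<^sup>2 - d x\<^sup>2\<close>, an anisotropic form modulo \<open>p\<close>.\<close>

lemma davenport_eq_loewy_heisenberg:
  "davenport_constant G = loewy_length (group_algebra (residue_ring (int p)) G)"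
proof -
  obtain d where d: "0 \<le> d" "d < int p"
    and aniso: "\<And>x y. [y\<^sup>2 = d * x\<^sup>2] (mod int p) \<Longrightarrow> int p dvd x \<and> int p dvd y"
    using exists_anisotropic[OF p_prime p_odd] by blast
  \<comment> \<open>Modulo p this is 1 - d, which turns t x^2 + 2xy + y^2 into (x + y)^2 - d x^2;
    adding p keeps it a natural number.\<close>
  define t where "t = nat (int p + 1 - d)"
  have t: "int t = int p + 1 - d" using d by (simp add: t_def)
  \<comment> \<open>The inverse of 2 modulo p, so that the exponents of \<open>c\<close> in
    \<open>g1\<close> and \<open>g2\<close> meet the hypothesis of \<open>nf_pow\<close>.\<close>
  define q where "q = (p + 1) div 2"
  have q: "2 * q = p + 1" using p_odd by (auto simp: q_def)
  define g1 where "g1 = b [^] t \<otimes> (a [^] (1::nat) \<otimes> c [^] (q * t))"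
  define g2 where "g2 = b [^] (1::nat) \<otimes> (a [^] (1::nat) \<otimes> c [^] q)"
  have g1: "nf t 1 (q * t) g1" and g2: "nf 1 1 q g2"
    unfolding nf_def g1_def g2_def using cong_refl by blast+
  have gc: "g1 \<in> carrier G" "g2 \<in> carrier G" using g1 g2 nf_closed by blast+
  have q2: "[2 * (q * t) = t * 1] (mod p)" "[2 * q = 1 * 1] (mod p)"
  proof -
    have "2 * (q * t) = p * t + t" using q by (metis add_mult_distrib mult.assoc mult_1)
    then show "[2 * (q * t) = t * 1] (mod p)" by (simp add: cong_def)
    show "[2 * q = 1 * 1] (mod p)" unfolding q cong_def mod_add_self1 by simp
  qed
  have p0: "p ^ n > 0" for n using p_prime prime_gt_0_nat by simp
  let ?gs = "replicate (p ^ \<beta> - 1) b @ replicate (p - 1) g1 @ replicate (p - 1) g2 @ replicate (p ^ \<alpha> - 1) a"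
  show ?thesis
  proof (rule davenport_eq_loewy_of_free)
    show "length ?gs = (p ^ \<alpha> - 1) + (p ^ \<beta> - 1) + 2 * (p ^ \<sigma> - 1)" by (simp add: sigma)
    show "set ?gs \<subseteq> carrier G" using gc by auto
    fix ys assume ys: "subseq ys ?gs" and one: "foldr (\<otimes>) ys \<one> = \<one>"
    obtain j x y i where jxyi: "j \<le> p ^ \<beta> - 1" "x \<le> p - 1" "y \<le> p - 1" "i \<le> p ^ \<alpha> - 1"
      "ys = replicate j b @ replicate x g1 @ replicate y g2 @ replicate i a"
      using ys by (auto simp: subseq_append_iff dest!: subseq_replicate)
    have cl: "set (replicate n z) \<subseteq> carrier G" if "z \<in> carrier G" for n z using that by auto
    have prod: "b [^] j \<otimes> (g1 [^] x \<otimes> (g2 [^] y \<otimes> a [^] i)) = \<one>"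
      using one gc unfolding jxyi(5)
      by (simp add: foldr_append_mult foldr_replicate_mult cl del: foldr_replicate foldr_append set_replicate_conv_if)
    obtain e1 where e1: "nf (t * x) (1 * x) e1 (g1 [^] x)" "[2 * e1 = t * 1 * x\<^sup>2] (mod p)"
      using nf_pow[OF g1 q2(1)] by blast
    obtain e2 where e2: "nf (1 * y) (1 * y) e2 (g2 [^] y)" "[2 * e2 = 1 * 1 * y\<^sup>2] (mod p)"
      using nf_pow[OF g2 q2(2)] by blast
    \<comment> \<open>With \<open>b\<close> leftmost and \<open>a\<close> rightmost, the outer
      powers add nothing to the exponent of \<open>c\<close>; the mixed term \<open>x * y\<close>
      comes from g1^x meeting g2^y.\<close>
    have bj: "nf j 0 0 (b [^] j)" unfolding nf_def by (intro exI[of _ 0]) simp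
    have ai: "nf 0 i 0 (a [^] i)" unfolding nf_def by (intro exI[of _ i]) simp
    have "nf (j + (t * x + y)) (x + (y + i)) (e1 + e2 + x * y) \<one>"
      using nf_mult[OF bj nf_mult[OF e1(1) nf_mult[OF e2(1) ai]]] unfolding prod by simp
    then obtain z :: nat where z: "b [^] (j + (t * x + y)) \<otimes> (a [^] z \<otimes> c [^] (e1 + e2 + x * y)) = \<one>"
      unfolding nf_def by metis
    then have "p dvd e1 + e2 + x * y" using product_eq_one_imp_dvd(3)[OF z] by (simp add: sigma)
    then have "[0 = 2 * (e1 + e2 + x * y)] (mod p)" by (metis cong_0_iff cong_sym dvd_mult)
    also have "2 * (e1 + e2 + x * y) = 2 * e1 + 2 * e2 + 2 * (x * y)" by simp
    also have "[2 * e1 + 2 * e2 + 2 * (x * y) = t * x\<^sup>2 + y\<^sup>2 + 2 * (x * y)] (mod p)"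
      using e1(2) e2(2) by (intro cong_add) auto
    finally have "[0 = int t * (int x)\<^sup>2 + (int y)\<^sup>2 + 2 * (int x * int y)] (mod int p)"
      by (simp flip: cong_int_iff)
    then have "int p dvd int t * (int x)\<^sup>2 + (int y)\<^sup>2 + 2 * (int x * int y)"
      using cong_sym cong_0_iff by blast
    \<comment> \<open>Subtracting p x^2 replaces t = p + 1 - d by 1 - d and completes the
      square.\<close>
    then have "int p dvd int t * (int x)\<^sup>2 + (int y)\<^sup>2 + 2 * (int x * int y) - int p * (int x)\<^sup>2"
      by (intro dvd_diff) auto
    also have "int t * (int x)\<^sup>2 + (int y)\<^sup>2 + 2 * (int x * int y) - int p * (int x)\<^sup>2
        = (int (x + y))\<^sup>2 - d * (int x)\<^sup>2"
      by (simp add: t power2_eq_square algebra_simps)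
    finally have "[(int (x + y))\<^sup>2 = d * (int x)\<^sup>2] (mod int p)" by (simp add: cong_iff_dvd_diff)
    from aniso[OF this] have "p dvd x" "p dvd x + y" by (simp_all only: int_dvd_int_iff)
    then have "p dvd x" "p dvd y" by (simp_all add: dvd_add_right_iff)
    then have xy: "x = 0" "y = 0" using jxyi(2,3) p0[of 1] by (auto dest: dvd_imp_le)
    have "b [^] j \<otimes> (a [^] i \<otimes> c [^] (0::nat)) = \<one>" using prod xy by simp
    then have "p ^ \<beta> dvd j" "p ^ \<alpha> dvd i" by (rule product_eq_one_imp_dvd)+
    then have "j = 0" "i = 0" using jxyi(1,4) p0[of \<alpha>] p0[of \<beta>] by (auto dest: dvd_imp_le)
    then show "ys = []" using jxyi(5) xy by simp
  qed
qed

end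

end

section \<open>The three families as split extensions\<close>

theorem theorem1p5:
  fixes G :: "('a, 'b) monoid_scheme" (structure) and p :: nat
  assumes "Factorial_Ring.prime p" and "odd p"
    and "group G" and "finite (carrier G)" and "\<exists>n. order G = p ^ n"
    and "\<exists>x\<in>carrier G. \<exists>y\<in>carrier G. generate G {x, y} = carrier G"
    and "nilpotent_of_class G 2"
    and cases:
      "(\<exists>a\<in>carrier G. \<exists>b\<in>carrier G. \<exists>c\<in>carrier G. \<exists>N. \<exists>\<alpha> \<beta> \<gamma> :: nat.
          internal_direct_product G N (generate G {c}) (generate G {a}) \<and>
          internal_semidirect_product G N (generate G {b}) \<and>
          commutator G a b = c \<and> commutator G a c = \<one> \<and> commutator G b c = \<one> \<and>
          group.ord G a = p ^ \<alpha> \<and> group.ord G b = p ^ \<beta> \<and> group.ord G c = p ^ \<gamma> \<and>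
          \<alpha> \<ge> \<beta> \<and> \<beta> \<ge> \<gamma> \<and> \<gamma> \<ge> 1 \<and> \<gamma> = 1)
       \<or>
       (\<exists>a\<in>carrier G. \<exists>b\<in>carrier G. \<exists>\<alpha> \<beta> \<gamma> :: nat.
          internal_semidirect_product G (generate G {a}) (generate G {b}) \<and>
          commutator G a b = a [^] (p ^ (\<alpha> - \<gamma>)) \<and>
          group.ord G a = p ^ \<alpha> \<and> group.ord G b = p ^ \<beta> \<and>
          group.ord G (commutator G a b) = p ^ \<gamma> \<and>
          \<alpha> \<ge> 2 * \<gamma> \<and> \<beta> \<ge> \<gamma> \<and> \<gamma> \<ge> 1)
       \<or>
       (\<exists>a\<in>carrier G. \<exists>b\<in>carrier G. \<exists>c\<in>carrier G. \<exists>N. \<exists>\<alpha> \<beta> \<gamma> \<sigma> :: nat.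
          internal_direct_product G N (generate G {c}) (generate G {a}) \<and>
          internal_semidirect_product G N (generate G {b}) \<and>
          commutator G a b = a [^] (p ^ (\<alpha> - \<gamma>)) \<otimes> c \<and>
          commutator G c b =
            a [^] (- int (p ^ (2 * (\<alpha> - \<gamma>)))) \<otimes> c [^] (- int (p ^ (\<alpha> - \<gamma>))) \<and>
          group.ord G a = p ^ \<alpha> \<and> group.ord G b = p ^ \<beta> \<and> group.ord G c = p ^ \<sigma> \<and>
          \<beta> \<ge> \<gamma> \<and> \<gamma> > \<sigma> \<and> \<sigma> \<ge> 1 \<and> \<alpha> + \<sigma> \<ge> 2 * \<gamma> \<and> \<sigma> = 1)"
  shows "davenport_constant G = loewy_length (group_algebra (residue_ring (int p)) G)"
proof -
  note p = assms(1) and odd = assms(2) and fin = assms(4)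
  interpret group G by (rule assms(3))
  show ?thesis
    using cases
  proof (elim disjE bexE exE conjE, goal_cases)
    case (1 a b c N \<alpha> \<beta> \<gamma>)
    have "c \<otimes> b = b \<otimes> c"
      using 1(2,3,8) by (simp add: commutator_def m_assoc inv_solve_left')
    then have "commutator G c b = \<one>"
      using 1(2,3) by (simp add: commutator_def m_assoc inv_solve_left')
    then interpret S: split_extension G a b c N p \<alpha> \<beta> 1 0 1 0
      using 1(1-6,9-11,15) p odd fin by unfold_locales simp_all
    show ?case by (rule S.davenport_eq_loewy_heisenberg) simp_all
  next
    case (2 a b \<alpha> \<beta> \<gamma>)
    \<comment> \<open>The role of \<open>c\<close> is taken by the identity, with N generated by
      \<open>a\<close>.\<close>
    have "internal_direct_product G (generate G {a}) (generate G {\<one>}) (generate G {a})"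
    proof -
      have "generate G {a} \<subseteq> carrier G" using 2(1) by (intro generate_incl) simp
      then show ?thesis
        using 2(1) generate_is_subgroup[of "{a}"] generate.one[of G "{a}"] triv_subgroup
        unfolding internal_direct_product_def generate_one set_mult_def by (auto simp: subset_iff)
    qed
    \<comment> \<open>Here \<alpha> > \<gamma> since \<alpha> \<ge> 2\<gamma> and \<gamma> \<ge> 1,
      so the exponent has the form p u.\<close>
    moreover have "p ^ (\<alpha> - \<gamma>) = p * p ^ (\<alpha> - \<gamma> - 1)"
      using power_Suc[of p "\<alpha> - \<gamma> - 1"] 2(8,10) by (simp add: Suc_diff_Suc)
    ultimately interpret S: split_extension G a b \<one> "generate G {a}" p \<alpha> \<beta> 0 "p ^ (\<alpha> - \<gamma> - 1)" 0 0
      using 2(1-6) p odd fin by unfold_locales (simp_all add: commutator_def)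
    show ?case by (rule S.davenport_eq_loewy_trivial) simp
  next
    case (3 a b c N \<alpha> \<beta> \<gamma> \<sigma>)
    define k where "k = \<alpha> - \<gamma> - 1"
    \<comment> \<open>From \<alpha> + \<sigma> \<ge> 2\<gamma> and \<gamma> > \<sigma> it follows
      that \<alpha> > \<gamma>.\<close>
    have k: "\<alpha> - \<gamma> = Suc k" using 3(12-15) by (simp add: k_def)
    \<comment> \<open>Chosen so that p w is a natural number congruent to -p^(2(\<alpha>-\<gamma>))
      modulo the order p^\<alpha> of \<open>a\<close>.\<close>
    define w where "w = p ^ (2 * k + 1) * (p ^ \<alpha> - 1)"
    have p0: "p > 0" using p by (rule prime_gt_0_nat)
    have "c [^] (- int (p ^ (\<alpha> - \<gamma>))) = \<one>"
      using 3(3,10,15) by (simp add: int_pow_eq_id k)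
    moreover have "a [^] (- int (p ^ (2 * (\<alpha> - \<gamma>)))) = a [^] (p * w)"
    proof -
      have "int (p * w) - (- int (p ^ (2 * (\<alpha> - \<gamma>)))) = int (p ^ (2 * (\<alpha> - \<gamma>))) * int (p ^ \<alpha>)"
        using p0 by (simp add: w_def k of_nat_diff algebra_simps)
      then have "a [^] (int (p * w) - (- int (p ^ (2 * (\<alpha> - \<gamma>))))) = \<one>"
        using 3(1,8) by (simp only: int_pow_eq_id) simp
      then have "a [^] (- int (p ^ (2 * (\<alpha> - \<gamma>)))) = a [^] int (p * w)"
        using 3(1) by (simp only: int_pow_eq int_pow_eq_id)
      then show ?thesis by (simp only: int_pow_int)
    qed
    ultimately have "commutator G c b = a [^] (p * w)" using 3(1,7) by simp
    then interpret S: split_extension G a b c N p \<alpha> \<beta> 1 "p ^ k" 1 w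
      using 3(1-6,8-10,15) p odd fin k by unfold_locales simp_all
    show ?case by (rule S.davenport_eq_loewy_heisenberg) simp_all
  qed
qed

end
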